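(* Let $p$ be a prime and let $R$ be an integral domain containing a field of characteristic $p$. Let $\sigma\in \mathrm{J}_n(R)$ be a triangular automorphism of $R[x_1,\ldots,x_n]$ of order $p$. (i) If $n=2$, then $\sigma$ is exponential over $R$. (ii) If $n=2$ and $\sigma(x_1)\neq x_1$, then there exist $a\in R\setminus\{0\}$ and $\theta(x_1)\in\sum_{p\nmid i}Rx_1^i$ such that $\sigma(x_1)=x_1+a$ and $\sigma(x_2)=x_2+a^{-1}(\theta(x_1)-\theta(x_1+a))$. (iii) If $n=3$ and $R$ is a field, then $\sigma$ is exponential over $R$.
   Context: $R[x_1,\ldots,x_n]$ is the polynomial ring in $n$ variables over $R$. $\mathrm{J}_n(R)$ is the group of triangular automorphisms: those $\sigma\in\mathrm{Aut}_R R[x_1,\ldots,x_n]$ ($R$-algebra automorphisms) with $\sigma(x_i)\in R^*x_i+R[x_1,\ldots,x_{i-1}]$ for $i=1,\ldots,n$. A $\mathbf{G}_a$-action on a ring $B$ is a ring homomorphism $E:B\to B[T]$ ($T$ a variable) such that: (A1) $E$ followed by $T\mapsto 0$ is the identity of $B$; (A2) if $E(b)=\sum_i b_iT^i$, then $\sum_i E(b_i)|_{T=T_1}\,T_2^i=\sum_i b_i(T_1+T_2)^i$ in $B[T_1,T_2]$, for all $b\in B$. Its invariant ring is $B^E=\{b\in B\mid E(b)=b\}$. For $a\in B^E$, $E_a:B\to B$ is $E$ followed by $T\mapsto a$; it is an automorphism of $B$. For a subring $R\subset B$, $E$ is over $R$ if $R\subset B^E$. An automorphism $\sigma$ of $B$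 is exponential over $R$ if $\sigma=E_a$ for some $\mathbf{G}_a$-action $E$ on $B$ over $R$ and some $a\in B^E$. In (ii), $a^{-1}$ is taken in the field of fractions of $R$; the sum $\sum_{p\nmid i}Rx_1^i$ is over $i\ge 1$ not divisible by $p$. *)

theory Defs
  imports
    "HOL-Library.Poly_Mapping"
    "HOL-Library.Cardinality"
    "HOL-Computational_Algebra.Computational_Algebra"
    "Jordan_Normal_Form.Ring_Hom_Matrix"
begin

text \<open>
  Ring homomorphisms are those of the locale \<open>comm_ring_hom\<close>.  The polynomial ring in
  \<open>n\<close> variables has its variables indexed by a finite linearly ordered type \<open>'n\<close> with
  \<open>CARD('n) = n\<close>; the \<open>k\<close>-th variable belongs to the \<open>k\<close>-th smallest element of \<open>'n\<close>.
  A polynomial maps exponent vectors to coefficients.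
\<close>

type_synonym ('n, 'a) mpoly = "('n \<Rightarrow>\<^sub>0 nat) \<Rightarrow>\<^sub>0 'a"

definition Const :: "'a::comm_ring_1 \<Rightarrow> ('n, 'a) mpoly" where
  "Const c = Poly_Mapping.single 0 c"

definition Var :: "'n \<Rightarrow> ('n, 'a::comm_ring_1) mpoly" where
  "Var i = Poly_Mapping.single (Poly_Mapping.single i 1) 1"

definition vars :: "('n, 'a::comm_ring_1) mpoly \<Rightarrow> 'n set" where
  "vars f = (\<Union>m\<in>Poly_Mapping.keys f. Poly_Mapping.keys m)"

definition subst_poly :: "'a::comm_ring_1 poly \<Rightarrow> ('n, 'a) mpoly \<Rightarrow> ('n, 'a) mpoly" where
  "subst_poly \<theta> g = (\<Sum>i\<le>degree \<theta>. Const (coeff \<theta> i) * g ^ i)"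

definition to_fract_mpoly :: "('n, 'a::idom) mpoly \<Rightarrow> ('n, 'a fract) mpoly" where
  "to_fract_mpoly f = Poly_Mapping.map to_fract f"

definition algebra_automorphism ::
    "(('n, 'a::comm_ring_1) mpoly \<Rightarrow> ('n, 'a) mpoly) \<Rightarrow> bool" where
  "algebra_automorphism \<sigma> \<longleftrightarrow>
     comm_ring_hom \<sigma> \<and> (\<forall>c. \<sigma> (Const c) = Const c) \<and> bij \<sigma>"

definition triangular_automorphisms ::
    "(('n::{finite,linorder}, 'a::comm_ring_1) mpoly \<Rightarrow> ('n, 'a) mpoly) set" where
  "triangular_automorphisms =
     {\<sigma>. algebra_automorphism \<sigma> \<and>
          (\<forall>i. \<exists>u f. u dvd 1 \<and> vars f \<subseteq> {..<i} \<and> \<sigma> (Var i) = Const u * Var i + f)}"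

definition has_order :: "('b \<Rightarrow> 'b) \<Rightarrow> nat \<Rightarrow> bool" where
  "has_order \<sigma> m \<longleftrightarrow> 0 < m \<and> \<sigma> ^^ m = id \<and> (\<forall>k. 0 < k \<and> k < m \<longrightarrow> \<sigma> ^^ k \<noteq> id)"

text \<open>
  In the second axiom \<open>B[T\<^sub>1,T\<^sub>2]\<close> is \<open>'b poly poly\<close>, with inner variable \<open>T\<^sub>1\<close> and outer
  variable \<open>T\<^sub>2\<close>, so that \<open>T\<^sub>1 + T\<^sub>2\<close> is \<open>[:[:0, 1:], 1:]\<close>.
\<close>

definition Ga_action :: "('b::comm_ring_1 \<Rightarrow> 'b poly) \<Rightarrow> bool" where
  "Ga_action E \<longleftrightarrow>
     comm_ring_hom E \<and>
     (\<forall>b. poly (E b) 0 = b) \<and>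
     (\<forall>b. (\<Sum>i\<le>degree (E b). monom (E (coeff (E b) i)) i) =
          (\<Sum>i\<le>degree (E b). [:[:coeff (E b) i:]:] * [:[:0, 1:], 1:] ^ i))"

definition Ga_invariants :: "('b::comm_ring_1 \<Rightarrow> 'b poly) \<Rightarrow> 'b set" where
  "Ga_invariants E = {b. E b = [:b:]}"

definition Ga_specialize :: "('b::comm_ring_1 \<Rightarrow> 'b poly) \<Rightarrow> 'b \<Rightarrow> 'b \<Rightarrow> 'b" where
  "Ga_specialize E a = (\<lambda>b. poly (E b) a)"

definition exponential_over :: "'b::comm_ring_1 set \<Rightarrow> ('b \<Rightarrow> 'b) \<Rightarrow> bool" where
  "exponential_over R \<sigma> \<longleftrightarrow>
     (\<exists>E a. Ga_action E \<and> R \<subseteq> Ga_invariants E \<and> a \<in> Ga_invariants E \<and>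
            \<sigma> = Ga_specialize E a)"

end

theory Submission
  imports Defs "Jordan_Normal_Form.Char_Poly" "HOL-Number_Theory.Cong"
begin

text \<open>
  A triangular automorphism of order \<open>p\<close> is unipotent, because \<open>u\<^sup>p = 1\<close> forces \<open>u = 1\<close> in
  characteristic \<open>p\<close>.  If \<open>\<sigma>(x) = x + a\<close> with \<open>a \<noteq> 0\<close> and \<open>\<sigma>(y) = y + f(x)\<close>, then
  \<open>\<sigma>\<^sup>p = id\<close> says that \<open>f\<close> has trace zero under the shift \<open>x \<mapsto> x + a\<close>, and an additive
  Hilbert 90 for this shift gives \<open>a f = \<theta>(x) - \<theta>(x + a)\<close> without denominators, by
  descending on the degree: the trace of a polynomial of degree \<open>-1\<close> modulo \<open>p\<close> never
  vanishes, so the leading term can always be integrated.  Thus \<open>a y + \<theta>(x)\<close> is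
  \<open>\<sigma>\<close>-invariant, and the action \<open>x \<mapsto> x + aT\<close> that also fixes \<open>a y + \<theta>(x)\<close> is integral
  since \<open>a\<close> divides \<open>\<theta>(x) - \<theta>(x + aT)\<close>; it specialises to \<open>\<sigma>\<close> at \<open>T = 1\<close>.  For three
  variables over a field the same argument is applied over \<open>R[x\<^sub>1]\<close> if \<open>x\<^sub>1\<close> is fixed, and
  otherwise over \<open>R[a x\<^sub>2 + \<theta>(x\<^sub>1)]\<close>.
\<close>

hide_const (open) Module.smult

section \<open>Trace-zero polynomials under a shift\<close>

text \<open>Polynomials in some of the variables do not form a type of their own, so coefficient
  conditions are carried by a subset. Differences together with \<open>1\<close> already yield
  \<open>0\<close>, negatives and sums.\<close>

definition is_subring :: "'a::comm_ring_1 set \<Rightarrow> bool" where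
  "is_subring S \<longleftrightarrow> 1 \<in> S \<and> (\<forall>x\<in>S. \<forall>y\<in>S. x - y \<in> S \<and> x * y \<in> S)"

lemma is_subringD:
  assumes "is_subring S"
  shows is_subring_1: "1 \<in> S" and is_subring_0: "0 \<in> S"
    and is_subring_diff: "x \<in> S \<Longrightarrow> y \<in> S \<Longrightarrow> x - y \<in> S"
    and is_subring_mult: "x \<in> S \<Longrightarrow> y \<in> S \<Longrightarrow> x * y \<in> S"
    and is_subring_uminus: "x \<in> S \<Longrightarrow> - x \<in> S"
    and is_subring_add: "x \<in> S \<Longrightarrow> y \<in> S \<Longrightarrow> x + y \<in> S"
proof -
  show 1: "1 \<in> S" and d: "\<And>x y. x \<in> S \<Longrightarrow> y \<in> S \<Longrightarrow> x - y \<in> S"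
    and "x \<in> S \<Longrightarrow> y \<in> S \<Longrightarrow> x * y \<in> S"
    using assms by (auto simp: is_subring_def)
  show 0: "0 \<in> S" using d[OF 1 1] by simp
  show m: "- x \<in> S" if "x \<in> S" for x using d[OF 0 that] by simp
  show "x \<in> S \<Longrightarrow> y \<in> S \<Longrightarrow> x + y \<in> S" using d[of x "- y"] m[of y] by simp
qed

lemma is_subring_sum:
  assumes "is_subring S" "\<And>i. i \<in> A \<Longrightarrow> f i \<in> S"
  shows "sum f A \<in> S"
  using assms(2)
  by (induction A rule: infinite_finite_induct)
    (auto simp: is_subring_0[OF assms(1)] intro: is_subring_add[OF assms(1)])

lemma is_subring_power: "is_subring S \<Longrightarrow> x \<in> S \<Longrightarrow> x ^ n \<in> S"
  by (induction n) (simp_all add: is_subring_1 is_subring_mult)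

lemma is_subring_of_nat: "is_subring S \<Longrightarrow> of_nat n \<in> S"
  by (induction n) (simp_all add: is_subring_0 is_subring_1 is_subring_add)

section \<open>Power sums and binomial coefficients modulo \<open>p\<close>\<close>

lemma of_nat_power_CHAR:
  assumes "prime p" "CHAR('a::idom) = p"
  shows "(of_nat j :: 'a) ^ p = of_nat j"
proof (induction j)
  case 0
  then show ?case using assms(1) prime_gt_0_nat by simp
next
  case (Suc j)
  then show ?case
    using freshmans_dream[of p "1 :: 'a" "of_nat j", unfolded assms(2), OF assms(1) refl]
    unfolding of_nat_Suc by simp
qed

text \<open>Summing \<open>(j+1)^(k+1) - j^(k+1)\<close> over \<open>j < p\<close> telescopes to
  \<open>p^(k+1) = 0\<close>. After binomial expansion the lower power sums vanish by induction,
  which leaves \<open>k+1\<close> times the sum in question, and \<open>k+1 < p\<close> is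
  cancelled.\<close>

lemma sum_powers_CHAR_eq_0:
  assumes "prime p" "CHAR('a::idom) = p" "k < p - 1"
  shows "(\<Sum>j<p. (of_nat j :: 'a) ^ k) = 0"
  using assms(3)
proof (induction k rule: less_induct)
  case (less k)
  let ?S = "\<lambda>i. \<Sum>j<p. (of_nat j :: 'a) ^ i"
  have p0: "(of_nat p :: 'a) = 0"
    using assms(2) by (simp add: of_nat_eq_0_iff_char_dvd)
  have step: "(of_nat (Suc j) :: 'a) ^ Suc k - of_nat j ^ Suc k
      = (\<Sum>i\<le>k. of_nat (Suc k choose i) * of_nat j ^ i)" for j
    using binomial_ring[of "of_nat j :: 'a" 1 "Suc k"] by (simp add: add.commute)
  have "0 = (\<Sum>j<p. (of_nat (Suc j) :: 'a) ^ Suc k - of_nat j ^ Suc k)"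
    by (subst sum_lessThan_telescope) (simp add: p0)
  also have "\<dots> = (\<Sum>i\<le>k. of_nat (Suc k choose i) * ?S i)"
    unfolding step sum_distrib_left by (rule sum.swap)
  also have "\<dots> = (\<Sum>i\<in>{k}. of_nat (Suc k choose i) * ?S i)"
    using less by (intro sum.mono_neutral_right) auto
  finally have "of_nat (Suc k) * ?S k = 0" by simp
  moreover have "(of_nat (Suc k) :: 'a) \<noteq> 0"
    using less.prems assms(2) nat_dvd_not_less[of "Suc k" p]
    by (simp add: of_nat_eq_0_iff_char_dvd del: of_nat_Suc)
  ultimately show ?case by (simp del: of_nat_Suc)
qed

text \<open>By Fermat's little theorem each nonzero \<open>j\<close> contributes \<open>1\<close>,
  while \<open>j = 0\<close> contributes \<open>0\<close> because \<open>p - 1 > 0\<close>; the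
  total is \<open>p - 1\<close>.\<close>

lemma sum_powers_CHAR_eq_m1:
  assumes "prime p" "CHAR('a::idom) = p"
  shows "(\<Sum>j<p. (of_nat j :: 'a) ^ (p - 1)) = - 1"
proof -
  have p1: "p > 1" using assms(1) prime_gt_1_nat by blast
  have one: "(of_nat j :: 'a) ^ (p - 1) = 1" if "0 < j" "j < p" for j
  proof -
    have "(of_nat j :: 'a) * of_nat j ^ (p - 1) = of_nat j * 1"
      using of_nat_power_CHAR[OF assms, of j] p1 by (cases p) auto
    moreover have "(of_nat j :: 'a) \<noteq> 0"
      using that assms(2) nat_dvd_not_less[of j p] by (simp add: of_nat_eq_0_iff_char_dvd)
    ultimately show ?thesis using mult_left_cancel by blast
  qed
  have "{..<p} = insert 0 {1..<p}" using p1 by auto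
  then have "(\<Sum>j<p. (of_nat j :: 'a) ^ (p - 1)) = (\<Sum>j\<in>{1..<p}. of_nat j ^ (p - 1))"
    using p1 by simp
  also have "\<dots> = (\<Sum>j\<in>{1..<p}. 1)" using one by (intro sum.cong) auto
  also have "\<dots> = of_nat p - 1" using p1 by (simp add: of_nat_diff)
  also have "\<dots> = - 1"
    using assms(2) of_nat_eq_0_iff_char_dvd[of p, where 'a = 'a] by simp
  finally show ?thesis .
qed

text \<open>Induction on \<open>k\<close> through
  \<open>(k+1) (d choose (k+1)) = (d-k) (d choose k)\<close>: as \<open>d\<close> is
  \<open>-1\<close> modulo \<open>p\<close>, the factor \<open>d - k\<close> is
  \<open>-(k+1)\<close>, nonzero modulo \<open>p\<close>.\<close>

lemma prime_not_dvd_binomial: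
  fixes d k p :: nat
  assumes "prime p" "p dvd Suc d" "k < p"
  shows "\<not> p dvd (d choose k)"
  using assms(3)
proof (induction k)
  case 0
  then show ?case using assms(1) prime_gt_1_nat[of p] by auto
next
  case (Suc k)
  have "Suc k < Suc d"
    using Suc.prems assms(2) dvd_imp_le[of p "Suc d"] by simp
  have "\<not> p dvd d - k"
  proof
    assume "p dvd d - k"
    then have "p dvd Suc d - (d - k)" using assms(2) by (rule dvd_diff_nat[rotated])
    then have "p dvd Suc k" using \<open>Suc k < Suc d\<close> by (simp add: Suc_diff_le)
    then show False using Suc.prems nat_dvd_not_less[of "Suc k" p] by simp
  qed
  then have "\<not> p dvd (d - k) * (d choose k)"
    using Suc assms(1) by (simp add: prime_dvd_mult_iff)
  moreover have "Suc k * (d choose Suc k) = (d - k) * (d choose k)"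
    by (metis binomial_absorb_comp binomial_absorption)
  ultimately show ?case by (metis dvd_mult)
qed

section \<open>Shifts of univariate polynomials and additive Hilbert 90\<close>

lemma coeff_linear_power_shift:
  "coeff ([:b, 1:] ^ n) i = of_nat (n choose i) * (b :: 'a::comm_ring_1) ^ (n - i)"
proof (cases "i \<le> n")
  case True
  then show ?thesis by (simp add: coeff_linear_poly_power)
next
  case False
  then have "coeff ([:b, 1:] ^ n) i = 0"
    using degree_power_le[of "[:b, 1:]" n] by (intro coeff_eq_0) auto
  then show ?thesis using False by (simp add: binomial_eq_0)
qed

lemma coeff_pcompose_shift:
  fixes f :: "'a::comm_ring_1 poly"
  assumes "\<And>i. i > d \<Longrightarrow> coeff f i = 0"
  shows "coeff (f \<circ>\<^sub>p [:b, 1:]) e = (\<Sum>i\<le>d. coeff f i * (of_nat (i choose e) * b ^ (i - e)))"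
proof -
  have "f = (\<Sum>i\<le>d. monom (coeff f i) i)"
    using assms by (intro poly_as_sum_of_monoms'[symmetric] degree_le) auto
  then have "f \<circ>\<^sub>p [:b, 1:] = (\<Sum>i\<le>d. monom (coeff f i) i \<circ>\<^sub>p [:b, 1:])"
    by (metis pcompose_sum)
  also have "\<dots> = (\<Sum>i\<le>d. smult (coeff f i) ([:b, 1:] ^ i))"
    by (simp add: pcompose_altdef map_poly_monom poly_monom)
  finally show ?thesis
    by (simp add: coeff_sum coeff_linear_power_shift)
qed

text \<open>
  In the coefficient of the trace at degree \<open>d - (p - 1)\<close> only the term \<open>i = d\<close> survives, since
  \<open>\<Sum>j<p. j\<^sup>k\<close> vanishes for \<open>k < p - 1\<close>; its binomial factor is prime to \<open>p\<close>.
\<close>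

lemma shift_trace_lead:
  fixes f :: "'a::idom poly"
  assumes p: "prime p" "CHAR('a) = p" and "a \<noteq> 0"
    and deg: "\<And>i. i > d \<Longrightarrow> coeff f i = 0" and d: "p dvd Suc d"
    and tr: "(\<Sum>j<p. f \<circ>\<^sub>p [:of_nat j * a, 1:]) = 0"
  shows "coeff f d = 0"
proof -
  define e where "e = d - (p - 1)"
  have p1: "p > 1" using p(1) prime_gt_1_nat by blast
  \<comment> \<open>Hence the natural subtraction defining \<open>e\<close> is not
    truncated.\<close>
  have pd: "p - 1 \<le> d" using dvd_imp_le[OF d] by simp
  have "0 = (\<Sum>j<p. coeff (f \<circ>\<^sub>p [:of_nat j * a, 1:]) e)"
    using arg_cong[OF tr, of "\<lambda>q. coeff q e"] by (simp add: coeff_sum)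
  also have "\<dots> = (\<Sum>j<p. \<Sum>i\<le>d. coeff f i * (of_nat (i choose e) * (of_nat j * a) ^ (i - e)))"
    by (simp add: coeff_pcompose_shift[OF deg])
  also have "\<dots> = (\<Sum>i\<le>d. coeff f i * of_nat (i choose e) * a ^ (i - e) *
      (\<Sum>j<p. of_nat j ^ (i - e)))"
    by (subst sum.swap) (simp add: sum_distrib_left power_mult_distrib mult_ac)
  also have "\<dots> = (\<Sum>i\<in>{d}. coeff f i * of_nat (i choose e) * a ^ (i - e) *
      (\<Sum>j<p. of_nat j ^ (i - e)))"
  proof (intro sum.mono_neutral_right ballI)
    fix i assume "i \<in> {..d} - {d}"
    then have "i < d" by auto
    show "coeff f i * of_nat (i choose e) * a ^ (i - e) * (\<Sum>j<p. of_nat j ^ (i - e)) = 0"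
    proof (cases "i < e")
      case True
      then show ?thesis by (simp add: binomial_eq_0)
    next
      case False
      then have "i - e < p - 1" using \<open>i < d\<close> pd by (auto simp: e_def)
      then show ?thesis using sum_powers_CHAR_eq_0[OF p] by simp
    qed
  qed auto
  also have "\<dots> = - (coeff f d * of_nat (d choose e) * a ^ (p - 1))"
    using pd sum_powers_CHAR_eq_m1[OF p] by (simp add: e_def)
  finally have "coeff f d * of_nat (d choose e) * a ^ (p - 1) = 0" by simp
  \<comment> \<open>By symmetry \<open>d choose e\<close> is \<open>d choose (p - 1)\<close>, to
    which \<open>prime_not_dvd_binomial\<close> applies.\<close>
  moreover have "(of_nat (d choose e) :: 'a) \<noteq> 0"
    using prime_not_dvd_binomial[OF p(1) d, of "p - 1"] p1 p(2) binomial_symmetric[OF pd]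
    by (simp add: of_nat_eq_0_iff_char_dvd e_def)
  ultimately show ?thesis using \<open>a \<noteq> 0\<close> by simp
qed

text \<open>In the binomial expansion every term other than the leading one carries a factor
  \<open>a\<close>. Taking it out explicitly keeps the quotient \<open>h\<close> over
  \<open>S\<close>; its top coefficient \<open>d+1\<close> is what the descent in Hilbert 90 has to
  invert.\<close>

lemma shift_difference_monom:
  fixes a :: "'a::comm_ring_1"
  assumes "is_subring S" "a \<in> S"
  obtains h where "\<And>i. coeff h i \<in> S" "\<And>i. i > d \<Longrightarrow> coeff h i = 0"
    "coeff h d = of_nat (Suc d)" "[:a, 1:] ^ Suc d - monom 1 (Suc d) = smult a h"
proof
  define h where "h = (\<Sum>k\<le>d. monom (of_nat (Suc d choose k) * a ^ (d - k)) k)"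
  have c: "coeff h i = (if i \<le> d then of_nat (Suc d choose i) * a ^ (d - i) else 0)" for i
    by (auto simp: h_def coeff_sum if_distrib[of "\<lambda>x. x * _"] cong: if_cong)
  show "coeff h i \<in> S" for i
    using assms unfolding c by (auto intro!: is_subring_0 is_subring_mult is_subring_of_nat is_subring_power)
  show "\<And>i. i > d \<Longrightarrow> coeff h i = 0" by (simp add: c)
  show "coeff h d = of_nat (Suc d)" by (simp add: c)
  show "[:a, 1:] ^ Suc d - monom 1 (Suc d) = smult a h"
  proof (rule poly_eqI)
    fix i
    show "coeff ([:a, 1:] ^ Suc d - monom 1 (Suc d)) i = coeff (smult a h) i"
      unfolding coeff_diff coeff_smult c coeff_linear_power_shift
      by (cases i "Suc d" rule: linorder_cases)
        (auto simp: Suc_diff_le mult_ac binomial_eq_0 simp del: binomial_Suc_Suc)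
  qed
qed

text \<open>Descent on the degree \<open>d\<close> of \<open>f\<close>. If \<open>p\<close> divides
  \<open>d+1\<close>, the trace condition kills the top coefficient; otherwise \<open>d+1\<close> is
  invertible modulo \<open>p\<close> and a monomial of degree \<open>d+1\<close> integrates the top
  term. Only such exponents enter \<open>\<theta>\<close>, so none is divisible by \<open>p\<close>,
  and in particular there is no constant term.\<close>

lemma additive_hilbert_90_shift:
  fixes f :: "'a::idom poly"
  assumes p: "prime p" "CHAR('a) = p" and S: "is_subring S" and a: "a \<in> S" "a \<noteq> 0"
    and f: "\<And>i. coeff f i \<in> S"
    and tr: "(\<Sum>j<p. f \<circ>\<^sub>p [:of_nat j * a, 1:]) = 0"
  obtains \<theta> where "\<And>i. coeff \<theta> i \<in> S" "\<And>i. p dvd i \<Longrightarrow> coeff \<theta> i = 0"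
    "smult a f = \<theta> - \<theta> \<circ>\<^sub>p [:a, 1:]"
proof -
  \<comment> \<open>The induction runs over a strict bound on the exponents instead of
    \<open>degree f\<close>, so that \<open>f = 0\<close> is the base case.\<close>
  have "\<exists>\<theta>. (\<forall>i. coeff \<theta> i \<in> S) \<and> (\<forall>i. p dvd i \<longrightarrow> coeff \<theta> i = 0) \<and> smult a f = \<theta> - \<theta> \<circ>\<^sub>p [:a, 1:]"
    if "\<And>i. i \<ge> n \<Longrightarrow> coeff f i = 0" for n
    using that f tr
  proof (induction n arbitrary: f)
    case 0
    then have "f = 0" by (intro poly_eqI) simp
    then show ?case using is_subring_0[OF S] by (intro exI[of _ 0]) simp
  next
    case (Suc d)
    show ?case
    proof (cases "coeff f d = 0")
      case True
      then have "coeff f i = 0" if "i \<ge> d" for i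
        using Suc.prems(1)[of i] that by (cases "i = d") auto
      then show ?thesis using Suc by blast
    next
      case False
      have "\<not> p dvd Suc d"
        using shift_trace_lead[OF p a(2), of d f] Suc.prems False by auto
      then have "coprime (Suc d) p"
        using p(1) by (simp add: prime_imp_coprime coprime_commute)
      \<comment> \<open>The inverse of \<open>d+1\<close> is taken as a natural number, which lies
        in \<open>S\<close> although \<open>S\<close> need not contain other inverses.\<close>
      then obtain m where "[Suc d * m = 1] (mod p)"
        using cong_solve_coprime_nat[of "Suc d" p] unfolding One_nat_def by blast
      then have m: "(of_nat (Suc d * m) :: 'a) = 1"
        using p(2) by (metis of_nat_1 of_nat_eq_iff_cong_CHAR)
      \<comment> \<open>With this \<open>c\<close> the top coefficient of \<open>smult c h\<close>
        equals that of \<open>f\<close>.\<close>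
      define c where "c = of_nat m * coeff f d"
      have cS: "c \<in> S"
        using S Suc.prems(2) by (auto simp: c_def intro: is_subring_mult is_subring_of_nat)
      obtain h where h: "\<And>i. coeff h i \<in> S" "\<And>i. i > d \<Longrightarrow> coeff h i = 0"
        "coeff h d = of_nat (Suc d)" "[:a, 1:] ^ Suc d - monom 1 (Suc d) = smult a h"
        using shift_difference_monom[OF S a(1)] by metis
      \<comment> \<open>The minus sign matches the order
        \<open>\<theta> - \<theta> \<circ>\<^sub>p [:a, 1:]\<close> in the goal.\<close>
      define \<theta>0 where "\<theta>0 = monom (- c) (Suc d)"
      have \<theta>0: "\<theta>0 - \<theta>0 \<circ>\<^sub>p [:a, 1:] = smult a (smult c h)"
      proof -
        have "\<theta>0 \<circ>\<^sub>p [:a, 1:] = smult (- c) ([:a, 1:] ^ Suc d)"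
          unfolding \<theta>0_def by (simp add: pcompose_altdef map_poly_monom poly_monom)
        moreover have "\<theta>0 = smult (- c) (monom 1 (Suc d))"
          by (simp add: \<theta>0_def smult_monom)
        ultimately have "\<theta>0 - \<theta>0 \<circ>\<^sub>p [:a, 1:] = smult c ([:a, 1:] ^ Suc d - monom 1 (Suc d))"
          by (simp add: smult_diff_right)
        then show ?thesis unfolding h(4) by (simp add: mult.commute)
      qed
      let ?T = "\<lambda>j. [:of_nat j * a, 1:]"
      have "[:a, 1:] \<circ>\<^sub>p ?T j = ?T (Suc j)" for j
        by (simp add: pcompose_pCons algebra_simps)
      then have shift: "(\<theta>0 \<circ>\<^sub>p [:a, 1:]) \<circ>\<^sub>p ?T j = \<theta>0 \<circ>\<^sub>p ?T (Suc j)" for j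
        by (metis pcompose_assoc)
      \<comment> \<open>The correction \<open>smult c h\<close> has trace zero too, as the induction
        hypothesis demands: \<open>a\<close> times it is a shift difference, its trace telescopes
        over a full period because \<open>p a = 0\<close>, and \<open>a\<close> cancels.\<close>
      have "smult a (\<Sum>j<p. smult c h \<circ>\<^sub>p ?T j) = (\<Sum>j<p. (\<theta>0 - \<theta>0 \<circ>\<^sub>p [:a, 1:]) \<circ>\<^sub>p ?T j)"
        unfolding \<theta>0 by (simp add: pcompose_smult smult_sum2)
      also have "\<dots> = (\<Sum>j<p. \<theta>0 \<circ>\<^sub>p ?T j - \<theta>0 \<circ>\<^sub>p ?T (Suc j))"
        by (simp add: pcompose_diff shift)
      also have "\<dots> = \<theta>0 \<circ>\<^sub>p ?T 0 - \<theta>0 \<circ>\<^sub>p ?T p"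
        by (rule sum_lessThan_telescope')
      also have "\<dots> = 0"
        using p(2) of_nat_eq_0_iff_char_dvd[of p, where 'a = 'a] by simp
      finally have trh: "(\<Sum>j<p. smult c h \<circ>\<^sub>p ?T j) = 0" using a(2) by simp
      have "\<exists>\<theta>. (\<forall>i. coeff \<theta> i \<in> S) \<and> (\<forall>i. p dvd i \<longrightarrow> coeff \<theta> i = 0) \<and>
          smult a (f - smult c h) = \<theta> - \<theta> \<circ>\<^sub>p [:a, 1:]"
      proof (rule Suc.IH)
        fix i assume "i \<ge> d"
        show "coeff (f - smult c h) i = 0"
        proof (cases "i = d")
          case True
          have "c * of_nat (Suc d) = coeff f d"
            using arg_cong[OF m, of "\<lambda>x. coeff f d * x"] unfolding c_def of_nat_mult
            by (simp only: mult_ac mult_1_left mult_1_right)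
          then show ?thesis using True h(3) by simp
        next
          case False
          then show ?thesis using \<open>i \<ge> d\<close> Suc.prems(1)[of i] h(2)[of i] by simp
        qed
      next
        show "coeff (f - smult c h) i \<in> S" for i
          unfolding coeff_diff coeff_smult
          by (intro is_subring_diff[OF S] is_subring_mult[OF S] Suc.prems(2) cS h(1))
        show "(\<Sum>j<p. (f - smult c h) \<circ>\<^sub>p ?T j) = 0"
          unfolding pcompose_diff sum_subtractf trh Suc.prems(3) by simp
      qed
      then obtain \<theta> where \<theta>: "\<And>i. coeff \<theta> i \<in> S" "\<And>i. p dvd i \<Longrightarrow> coeff \<theta> i = 0"
        "smult a (f - smult c h) = \<theta> - \<theta> \<circ>\<^sub>p [:a, 1:]" by blast
      have "smult a f = (\<theta> + \<theta>0) - (\<theta> + \<theta>0) \<circ>\<^sub>p [:a, 1:]"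
      proof -
        have "smult a f = smult a (f - smult c h) + smult a (smult c h)"
          unfolding smult_diff_right by simp
        then show ?thesis
          unfolding \<theta>(3) \<theta>0[symmetric] pcompose_add by simp
      qed
      moreover have "coeff (\<theta> + \<theta>0) i \<in> S" for i
        unfolding coeff_add \<theta>0_def coeff_monom
        using is_subring_uminus[OF S cS] is_subring_0[OF S]
        by (intro is_subring_add[OF S] \<theta>(1)) simp
      moreover have "coeff (\<theta> + \<theta>0) i = 0" if "p dvd i" for i
        using \<theta>(2)[OF that] that \<open>\<not> p dvd Suc d\<close> by (auto simp: \<theta>0_def)
      ultimately show ?thesis by blast
    qed
  qed
  from this[of "Suc (degree f)"] show thesis
    using that by (auto simp: coeff_eq_0)
qed

section \<open>Homomorphisms from multivariate polynomial rings\<close>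

lemma poly_mapping_sum_single:
  fixes f :: "'m \<Rightarrow>\<^sub>0 'a::comm_monoid_add"
  shows "f = (\<Sum>m\<in>Poly_Mapping.keys f. Poly_Mapping.single m (Poly_Mapping.lookup f m))"
  by (rule poly_mapping_eqI) (simp add: lookup_sum lookup_single when_def in_keys_iff)

text \<open>The monomial case may assume that the exponent occurs in \<open>f\<close>; this is what
  lets later inductions see only the variables of \<open>f\<close>.\<close>

lemma poly_mapping_add_induct [case_names zero single add]:
  fixes f :: "'m \<Rightarrow>\<^sub>0 'a::comm_monoid_add"
  assumes "P 0" "\<And>m c. m \<in> Poly_Mapping.keys f \<Longrightarrow> P (Poly_Mapping.single m c)" "\<And>g h. P g \<Longrightarrow> P h \<Longrightarrow> P (g + h)"
  shows "P f"
proof -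
  have "P (\<Sum>m\<in>A. Poly_Mapping.single m (Poly_Mapping.lookup f m))"
    if "A \<subseteq> Poly_Mapping.keys f" for A
    using finite_subset[OF that finite_keys] that
    by (induction A rule: finite_induct) (auto intro: assms)
  from this[of "Poly_Mapping.keys f"] show ?thesis
    by (simp flip: poly_mapping_sum_single)
qed

text \<open>For additive \<open>h\<close> both sides of multiplicativity are biadditive, so
  monomials suffice, one factor at a time.\<close>

lemma poly_mapping_ring_homI:
  fixes h :: "('m::comm_monoid_add \<Rightarrow>\<^sub>0 'a::comm_ring_1) \<Rightarrow> 'b::comm_ring_1"
  assumes add: "\<And>f g. h (f + g) = h f + h g" and one: "h 1 = 1"
    and single: "\<And>m c n d. h (Poly_Mapping.single (m + n) (c * d))
      = h (Poly_Mapping.single m c) * h (Poly_Mapping.single n d)"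
  shows "comm_ring_hom h"
proof
  show zero: "h 0 = 0" using add[of 0 0] by simp
  have s: "h (Poly_Mapping.single m c * g) = h (Poly_Mapping.single m c) * h g" for m c g
    by (induction g rule: poly_mapping_add_induct)
      (simp_all add: zero add single mult_single distrib_left)
  show "h (f * g) = h f * h g" for f g
    by (induction f rule: poly_mapping_add_induct)
      (simp_all add: zero add s distrib_right)
qed (fact add one)+

lemma Const_hom: "inj_comm_ring_hom (Const :: 'a::comm_ring_1 \<Rightarrow> ('n, 'a) mpoly)"
  by unfold_locales
    (auto simp: Const_def single_add mult_single single_one dest: arg_cong[of _ _ "\<lambda>f. Poly_Mapping.lookup f 0"])

interpretation Const: inj_comm_ring_hom "Const :: 'a::comm_ring_1 \<Rightarrow> ('n, 'a) mpoly"
  by (fact Const_hom)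

text \<open>Hilbert 90 will be applied with the multivariate polynomial ring itself as coefficient
  ring.\<close>

lemma CHAR_mpoly: "CHAR(('n, 'a::comm_ring_1) mpoly) = CHAR('a)"
proof (rule CHAR_eqI)
  show "of_nat CHAR('a) = (0 :: ('n, 'a) mpoly)"
    by (metis Const.hom_of_nat Const.hom_zero of_nat_CHAR)
  show "CHAR('a) dvd n" if "of_nat n = (0 :: ('n, 'a) mpoly)" for n
    using that by (metis Const.hom_of_nat Const.hom_0_iff of_nat_eq_0_iff_char_dvd)
qed

lemma Var_power: "Var i ^ k = Poly_Mapping.single (Poly_Mapping.single i k) (1 :: 'a::comm_ring_1)"
proof (induction k)
  case (Suc k)
  then show ?case by (simp add: Var_def mult_single flip: single_add)
qed (simp flip: single_one)

lemma single_eq_Const_mult_prod_Var: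
  "Poly_Mapping.single m c =
    (Const c * (\<Prod>i\<in>Poly_Mapping.keys m. Var i ^ Poly_Mapping.lookup m i) :: ('n, 'a::comm_ring_1) mpoly)"
proof -
  have "(\<Prod>i\<in>A. Var i ^ Poly_Mapping.lookup m i) =
      Poly_Mapping.single (\<Sum>i\<in>A. Poly_Mapping.single i (Poly_Mapping.lookup m i)) (1 :: 'a)"
    if "finite A" for A
    using that by (induction A rule: finite_induct) (auto simp: Var_power mult_single single_one)
  then show ?thesis
    by (simp add: Const_def mult_single flip: poly_mapping_sum_single)
qed

lemma mpoly_induct [case_names Const Var add mult]:
  fixes f :: "('n, 'a::comm_ring_1) mpoly"
  assumes Const: "\<And>c. P (Const c)" and Var: "\<And>i. i \<in> vars f \<Longrightarrow> P (Var i)"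
    and add: "\<And>g h. P g \<Longrightarrow> P h \<Longrightarrow> P (g + h)" and mult: "\<And>g h. P g \<Longrightarrow> P h \<Longrightarrow> P (g * h)"
  shows "P f"
proof (induction f rule: poly_mapping_add_induct)
  case zero
  then show ?case using Const[of 0] by simp
next
  case (single m c)
  have 1: "P 1" using Const[of 1] by simp
  have pow: "P (Var i ^ k)" if "i \<in> Poly_Mapping.keys m" for i k
    using single that by (induction k) (auto intro!: 1 mult Var simp: vars_def)
  have "P (\<Prod>i\<in>A. Var i ^ Poly_Mapping.lookup m i)" if "A \<subseteq> Poly_Mapping.keys m" for A
    using finite_subset[OF that finite_keys] that
    by (induction A rule: finite_induct) (auto intro: 1 mult pow)
  then show ?case
    unfolding single_eq_Const_mult_prod_Var by (intro mult Const) simp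
next
  case (add g h)
  then show ?case by (rule assms(3))
qed

text \<open>Uniqueness in the universal property, relative to the variables that occur. With
  \<open>K\<close> the identity it shows that \<open>H\<close> fixes \<open>f\<close>; with
  \<open>K\<close> the embedding of constants it shows that \<open>f\<close> is invariant under an
  action.\<close>

lemma mpoly_hom_cong:
  fixes H K :: "('n, 'a::comm_ring_1) mpoly \<Rightarrow> 'b::comm_ring_1"
  assumes "comm_ring_hom H" "comm_ring_hom K"
    and "\<And>c. H (Const c) = K (Const c)" "\<And>i. i \<in> vars f \<Longrightarrow> H (Var i) = K (Var i)"
  shows "H f = K f"
proof -
  interpret H: comm_ring_hom H by fact
  interpret K: comm_ring_hom K by fact
  show ?thesis
    by (induction f rule: mpoly_induct) (use assms in \<open>auto simp: H.hom_add K.hom_add H.hom_mult K.hom_mult\<close>)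
qed

section \<open>Variables occurring in a polynomial\<close>

lemma vars_Const [simp]: "vars (Const c) = {}"
  by (auto simp: vars_def Const_def)

lemma vars_0 [simp]: "vars 0 = {}" and vars_1 [simp]: "vars 1 = {}"
  using vars_Const[of 0] vars_Const[of 1] by simp_all

lemma vars_Var [simp]: "vars (Var i :: ('n, 'a::comm_ring_1) mpoly) = {i}"
  by (simp add: vars_def Var_def)

lemma vars_diff: "vars (f - g) \<subseteq> vars f \<union> vars g"
  using keys_diff[of f g] by (auto simp: vars_def)

lemma vars_mult: "vars (f * g) \<subseteq> vars f \<union> vars g"
proof
  fix i assume "i \<in> vars (f * g)"
  then obtain k where k: "k \<in> Poly_Mapping.keys (f * g)" "i \<in> Poly_Mapping.keys k"
    by (auto simp: vars_def)
  then obtain a b where "a \<in> Poly_Mapping.keys f" "b \<in> Poly_Mapping.keys g" "k = a + b"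
    using keys_mult[of f g] by auto
  then show "i \<in> vars f \<union> vars g"
    using k Poly_Mapping.keys_add[of a b] by (auto simp: vars_def)
qed

lemma is_subring_vars: "is_subring {f :: ('n, 'a::comm_ring_1) mpoly. vars f \<subseteq> V}"
  using vars_diff vars_mult unfolding is_subring_def by (fastforce simp: subset_iff)

text \<open>A property stable under differences and products, seen as a subring, thus needs checking
  only on constants and variables.\<close>

lemma is_subring_mpoly:
  assumes S: "is_subring S" and "\<And>c. Const c \<in> S" "\<And>i. i \<in> vars f \<Longrightarrow> Var i \<in> S"
  shows "f \<in> S"
  by (induction f rule: mpoly_induct) (use assms in \<open>auto intro: is_subring_add[OF S] is_subring_mult[OF S]\<close>)

lemma vars_hom:
  fixes H :: "('n, 'a::comm_ring_1) mpoly \<Rightarrow> ('m, 'b::comm_ring_1) mpoly"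
  assumes "comm_ring_hom H" "\<And>c. vars (H (Const c)) \<subseteq> V" "\<And>i. i \<in> vars f \<Longrightarrow> vars (H (Var i)) \<subseteq> V"
  shows "vars (H f) \<subseteq> V"
proof -
  interpret H: comm_ring_hom H by fact
  have "is_subring {f. vars (H f) \<subseteq> V}"
    using vars_diff vars_mult unfolding is_subring_def by (fastforce simp: subset_iff H.hom_minus H.hom_mult)
  from is_subring_mpoly[OF this, of f] show ?thesis using assms by auto
qed

lemma vars_empty_iff: "vars f = {} \<longleftrightarrow> f \<in> range Const"
proof
  assume "vars f = {}"
  moreover have "is_subring (range Const)"
    unfolding is_subring_def
    by (auto simp flip: Const.hom_one Const.hom_minus Const.hom_mult)
  ultimately show "f \<in> range Const"
    using is_subring_mpoly[of "range Const" f] by simp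
qed auto

lemma vars_poly:
  assumes "\<And>k. vars (coeff \<theta> k) \<subseteq> V" "vars x \<subseteq> V"
  shows "vars (poly \<theta> x) \<subseteq> V"
proof -
  note S = is_subring_vars[of V]
  show ?thesis
    using is_subring_sum[OF S] is_subring_mult[OF S] is_subring_power[OF S] assms
    unfolding poly_altdef by (metis (no_types, lifting) mem_Collect_eq)
qed

text \<open>Existence in the universal property. The product runs over all variables and not just
  over the support of \<open>m\<close>, so that monomials with different supports multiply
  uniformly.\<close>

definition mpoly_eval :: "('a::comm_ring_1 \<Rightarrow> 'b::comm_ring_1) \<Rightarrow> ('n::finite \<Rightarrow> 'b) \<Rightarrow> ('n, 'a) mpoly \<Rightarrow> 'b" where
  "mpoly_eval \<phi> g f = (\<Sum>m\<in>Poly_Mapping.keys f. \<phi> (Poly_Mapping.lookup f m) * (\<Prod>i\<in>UNIV. g i ^ Poly_Mapping.lookup m i))"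

lemma
  assumes "comm_ring_hom \<phi>"
  shows mpoly_eval_hom: "comm_ring_hom (mpoly_eval \<phi> g)"
    and mpoly_eval_Const: "mpoly_eval \<phi> g (Const c) = \<phi> c"
    and mpoly_eval_Var: "mpoly_eval \<phi> g (Var i) = g i"
proof -
  interpret \<phi>: comm_ring_hom \<phi> by fact
  have single: "mpoly_eval \<phi> g (Poly_Mapping.single m c) = \<phi> c * (\<Prod>i\<in>UNIV. g i ^ Poly_Mapping.lookup m i)" for m c
    by (cases "c = 0") (simp_all add: mpoly_eval_def)
  show "mpoly_eval \<phi> g (Const c) = \<phi> c" by (simp add: Const_def single)
  have "g j ^ Poly_Mapping.lookup (Poly_Mapping.single i 1) j = (if j = i then g i else 1)" for j
    by (simp add: lookup_single when_def)
  then show "mpoly_eval \<phi> g (Var i) = g i" by (simp add: Var_def single)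
  show "comm_ring_hom (mpoly_eval \<phi> g)"
  proof (rule poly_mapping_ring_homI)
    show "mpoly_eval \<phi> g 1 = 1" by (simp add: single flip: single_one)
    show "mpoly_eval \<phi> g (Poly_Mapping.single (m + n) (c * d)) =
        mpoly_eval \<phi> g (Poly_Mapping.single m c) * mpoly_eval \<phi> g (Poly_Mapping.single n d)" for m n c d
      by (simp add: single \<phi>.hom_mult lookup_add power_add prod.distrib mult_ac)
    show "mpoly_eval \<phi> g (f + h) = mpoly_eval \<phi> g f + mpoly_eval \<phi> g h" for f h
    proof -
      let ?t = "\<lambda>f m. \<phi> (Poly_Mapping.lookup f m) * (\<Prod>i\<in>UNIV. g i ^ Poly_Mapping.lookup m i)"
      let ?A = "Poly_Mapping.keys f \<union> Poly_Mapping.keys h"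
      \<comment> \<open>Cancellation may shrink the support of \<open>f + h\<close>, so all three
        sums are padded with zeros to the common index set \<open>?A\<close>.\<close>
      have "mpoly_eval \<phi> g q = sum (?t q) ?A" if "Poly_Mapping.keys q \<subseteq> ?A" for q
        unfolding mpoly_eval_def using that
        by (intro sum.mono_neutral_left) (auto simp: in_keys_iff)
      then show ?thesis
        using Poly_Mapping.keys_add[of f h]
        by (simp add: lookup_add \<phi>.hom_add distrib_right sum.distrib)
    qed
  qed
qed

section \<open>Polynomials in one distinguished variable\<close>

lemma const_poly_hom: "comm_ring_hom (\<lambda>c :: 'a::comm_ring_1. [:c:])"
  by unfold_locales auto

lemma comm_ring_hom_comp: "comm_ring_hom f \<Longrightarrow> comm_ring_hom g \<Longrightarrow> comm_ring_hom (\<lambda>x. f (g x))"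
proof -
  assume "comm_ring_hom f" "comm_ring_hom g"
  then interpret f: comm_ring_hom f + g: comm_ring_hom g .
  show ?thesis by unfold_locales (simp_all add: f.hom_add g.hom_add f.hom_mult g.hom_mult)
qed

lemma id_hom: "comm_ring_hom (\<lambda>x. x)"
  by unfold_locales auto

lemma poly_eval_hom: "comm_ring_hom (\<lambda>q :: 'a::comm_ring_1 poly. poly q x)"
  by unfold_locales auto

lemma map_poly_hom: "comm_ring_hom f \<Longrightarrow> comm_ring_hom (map_poly f)"
proof -
  assume "comm_ring_hom f"
  then interpret f: map_poly_comm_ring_hom f by (simp add: map_poly_comm_ring_hom_def)
  show ?thesis ..
qed

lemma hom_poly:
  assumes "comm_ring_hom h"
  shows "h (poly f x) = poly (map_poly h f) (h x)"
proof -
  interpret comm_ring_hom h by fact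
  show ?thesis by simp
qed

text \<open>The identification with univariate polynomials in \<open>Var i\<close> over the
  remaining variables. Coefficients stay in the same type; that \<open>Var i\<close> is absent from
  them is recorded through \<open>vars\<close>.\<close>

definition as_poly_in :: "'n \<Rightarrow> ('n::finite, 'a::comm_ring_1) mpoly \<Rightarrow> ('n, 'a) mpoly poly" where
  "as_poly_in i = mpoly_eval (\<lambda>c. [:Const c:]) (\<lambda>j. if j = i then [:0, 1:] else [:Var j:])"

lemmas const_poly_Const_hom = comm_ring_hom_comp[OF const_poly_hom Const.comm_ring_hom_axioms]

lemma as_poly_in_hom: "comm_ring_hom (as_poly_in i)"
  unfolding as_poly_in_def by (rule mpoly_eval_hom[OF const_poly_Const_hom])

lemma as_poly_in_Const [simp]: "as_poly_in i (Const c) = [:Const c:]"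
  unfolding as_poly_in_def by (rule mpoly_eval_Const[OF const_poly_Const_hom])

lemma as_poly_in_Var: "as_poly_in i (Var j) = (if j = i then [:0, 1:] else [:Var j:])"
  unfolding as_poly_in_def by (rule mpoly_eval_Var[OF const_poly_Const_hom])

lemma as_poly_in_const: "i \<notin> vars f \<Longrightarrow> as_poly_in i f = [:f:]"
  by (rule mpoly_hom_cong[OF as_poly_in_hom const_poly_hom]) (auto simp: as_poly_in_Var)

lemma poly_as_poly_in: "poly (as_poly_in i f) (Var i) = f"
  by (rule mpoly_hom_cong[OF comm_ring_hom_comp[OF poly_eval_hom as_poly_in_hom] id_hom])
    (auto simp: as_poly_in_Var)

text \<open>Univariate polynomials with all coefficients in a subring are closed under differences
  and, by the convolution formula, under products, which reduces the claim to constants and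
  variables.\<close>

lemma vars_coeff_as_poly_in:
  fixes f :: "('n::finite, 'a::comm_ring_1) mpoly"
  shows "vars (coeff (as_poly_in i f) k) \<subseteq> vars f - {i}"
proof -
  note S = is_subring_vars[of "vars f - {i}"]
  interpret comm_ring_hom "as_poly_in i" by (rule as_poly_in_hom)
  have step: "(\<forall>k. vars (coeff (as_poly_in i (g - h)) k) \<subseteq> vars f - {i}) \<and>
      (\<forall>k. vars (coeff (as_poly_in i (g * h)) k) \<subseteq> vars f - {i})"
    if "\<forall>k. vars (coeff (as_poly_in i g) k) \<subseteq> vars f - {i}"
      and "\<forall>k. vars (coeff (as_poly_in i h) k) \<subseteq> vars f - {i}"
    for g h :: "('n, 'a) mpoly"
  proof (intro conjI allI)
    fix k
    have g: "\<And>k. coeff (as_poly_in i g) k \<in> {q. vars q \<subseteq> vars f - {i}}"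
      and h: "\<And>k. coeff (as_poly_in i h) k \<in> {q. vars q \<subseteq> vars f - {i}}"
      using that by simp_all
    show "vars (coeff (as_poly_in i (g - h)) k) \<subseteq> vars f - {i}"
      using is_subring_diff[OF S g h, of k k] by (simp add: hom_minus)
    show "vars (coeff (as_poly_in i (g * h)) k) \<subseteq> vars f - {i}"
    proof -
      have "(\<Sum>l\<le>k. coeff (as_poly_in i g) l * coeff (as_poly_in i h) (k - l)) \<in> {q. vars q \<subseteq> vars f - {i}}"
        by (intro is_subring_sum[OF S] is_subring_mult[OF S] g h)
      then show ?thesis by (simp add: hom_mult coeff_mult)
    qed
  qed
  have "is_subring {g :: ('n, 'a) mpoly. \<forall>k. vars (coeff (as_poly_in i g) k) \<subseteq> vars f - {i}}"
    unfolding is_subring_def using step by (simp add: coeff_1)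
  from is_subring_mpoly[OF this, of f] show ?thesis
    by (auto simp: as_poly_in_Var coeff_pCons split: nat.splits)
qed

section \<open>Additive group actions\<close>

lemma is_subring_eq:
  assumes "comm_ring_hom f" "comm_ring_hom g"
  shows "is_subring {x. f x = g x}"
proof -
  interpret f: comm_ring_hom f by fact
  interpret g: comm_ring_hom g by fact
  show ?thesis
    by (simp add: is_subring_def f.hom_minus g.hom_minus f.hom_mult g.hom_mult)
qed

lemma map_poly_const_const_pCons:
  "map_poly (\<lambda>c :: 'a::zero. [:[:c:]:]) (pCons c q) = pCons [:[:c:]:] (map_poly (\<lambda>c. [:[:c:]:]) q)"
  by (rule Polynomial.map_poly_pCons) simp

text \<open>The two axioms at a single element. The sums are rewritten by \<open>map_poly\<close>
  and evaluation in \<open>B[T1,T2]\<close>, so that every side is visibly a ring homomorphism in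
  \<open>b\<close>.\<close>

definition Ga_at :: "('b::comm_ring_1 \<Rightarrow> 'b poly) \<Rightarrow> 'b \<Rightarrow> bool" where
  "Ga_at E b \<longleftrightarrow> poly (E b) 0 = b \<and>
     map_poly E (E b) = poly (map_poly (\<lambda>c. [:[:c:]:]) (E b)) [:[:0, 1:], 1:]"

lemma Ga_actionI:
  assumes "comm_ring_hom E" "\<And>b. Ga_at E b"
  shows "Ga_action E"
proof -
  interpret comm_ring_hom E by fact
  have "(\<Sum>i\<le>degree (E b). monom (E (coeff (E b) i)) i) = map_poly E (E b)" for b
    by (simp add: map_poly_hom_as_monom_sum)
  moreover have "(\<Sum>i\<le>degree (E b). [:[:coeff (E b) i:]:] * [:[:0, 1:], 1:] ^ i) =
      poly (map_poly (\<lambda>c. [:[:c:]:]) (E b)) [:[:0, 1:], 1:]" for b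
    by (subst poly_altdef) (simp add: coeff_map_poly degree_map_poly)
  ultimately show ?thesis
    using assms unfolding Ga_action_def Ga_at_def by metis
qed

context
  fixes E :: "'b::comm_ring_1 \<Rightarrow> 'b poly"
  assumes E: "comm_ring_hom E"
begin

interpretation E: comm_ring_hom E by (fact E)

lemma Ga_lhs_pCons: "map_poly E (pCons c q) = pCons (E c) (map_poly E q)"
  by (rule Polynomial.map_poly_pCons) (rule E.hom_zero)

lemma Ga_lhs_hom: "comm_ring_hom (\<lambda>b. map_poly E (E b))"
  by (rule comm_ring_hom_comp[OF map_poly_hom[OF E] E])

lemma Ga_rhs_hom: "comm_ring_hom (\<lambda>b. poly (map_poly (\<lambda>c. [:[:c:]:]) (E b)) t)"
  by (rule comm_ring_hom_comp[OF poly_eval_hom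
        comm_ring_hom_comp[OF map_poly_hom[OF comm_ring_hom_comp[OF const_poly_hom const_poly_hom]] E]])

text \<open>Each axiom equates two ring homomorphisms, and equalisers are subrings; the axioms
  therefore need testing only on generators.\<close>

lemma is_subring_Ga_at: "is_subring {b. Ga_at E b}"
proof -
  have "is_subring {b. poly (E b) 0 = b}"
    by (rule is_subring_eq[OF comm_ring_hom_comp[OF poly_eval_hom E] id_hom])
  moreover have "is_subring {b. map_poly E (E b) = poly (map_poly (\<lambda>c. [:[:c:]:]) (E b)) [:[:0, 1:], 1:]}"
    by (rule is_subring_eq[OF Ga_lhs_hom Ga_rhs_hom])
  ultimately show ?thesis
    by (simp add: is_subring_def Ga_at_def)
qed

lemma Ga_at_invariant: "E b = [:b:] \<Longrightarrow> Ga_at E b"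
  by (simp add: Ga_at_def Ga_lhs_pCons map_poly_const_const_pCons)

text \<open>Translation at an invariant speed: both sides of the second axiom are
  \<open>b + a (T1 + T2)\<close>.\<close>

lemma Ga_at_linear: "E b = [:b, a:] \<Longrightarrow> E a = [:a:] \<Longrightarrow> Ga_at E b"
  by (simp add: Ga_at_def Ga_lhs_pCons map_poly_const_const_pCons)

lemma Ga_at_poly:
  assumes "Ga_at E x" "\<And>k. Ga_at E (coeff \<theta> k)"
  shows "Ga_at E (poly \<theta> x)"
  using is_subring_sum[OF is_subring_Ga_at, of "{..degree \<theta>}" "\<lambda>k. coeff \<theta> k * x ^ k"]
    is_subring_mult[OF is_subring_Ga_at] is_subring_power[OF is_subring_Ga_at] assms
  by (simp add: poly_altdef)

end

text \<open>Multiplication by an invariant \<open>a\<close> scales both sides of each axiom by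
  \<open>a\<close>, which cancels in a domain. This passes from \<open>a * Var j\<close>, where the
  axioms are accessible, to \<open>Var j\<close>.\<close>

lemma Ga_at_cancel:
  fixes E :: "'b::idom \<Rightarrow> 'b poly"
  assumes E: "comm_ring_hom E" and a: "E a = [:a:]" "a \<noteq> 0" and ab: "Ga_at E (a * b)"
  shows "Ga_at E b"
proof -
  interpret E: comm_ring_hom E by fact
  interpret L: comm_ring_hom "\<lambda>b. map_poly E (E b)" by (rule Ga_lhs_hom[OF E])
  interpret R: comm_ring_hom "\<lambda>b. poly (map_poly (\<lambda>c. [:[:c:]:]) (E b)) [:[:0, 1:], 1:]"
    by (rule Ga_rhs_hom[OF E])
  have "a * poly (E b) 0 = a * b"
    using ab a(1) by (simp add: Ga_at_def E.hom_mult)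
  moreover have "[:[:a:]:] * map_poly E (E b) =
      [:[:a:]:] * poly (map_poly (\<lambda>c. [:[:c:]:]) (E b)) [:[:0, 1:], 1:]"
  proof -
    have "map_poly E (E a) = [:[:a:]:]" "poly (map_poly (\<lambda>c. [:[:c:]:]) (E a)) [:[:0, 1:], 1:] = [:[:a:]:]"
      using a(1) by (simp_all add: Ga_lhs_pCons[OF E] map_poly_const_const_pCons)
    then show ?thesis
      using ab unfolding Ga_at_def L.hom_mult R.hom_mult by simp
  qed
  ultimately show ?thesis
    unfolding Ga_at_def mult_cancel_left using a(2) by simp
qed

text \<open>The Taylor difference \<open>\<theta>(x) - \<theta>(x + aT)\<close> has the factor
  \<open>a\<close>, by Horner recursion. This is why the action has no denominators.\<close>

lemma pcompose_shift_dvd: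
  fixes \<theta> :: "'b::comm_ring_1 poly"
  shows "[:a:] dvd [:poly \<theta> x:] - \<theta> \<circ>\<^sub>p [:x, a:]"
proof (induction \<theta>)
  case (pCons c \<theta>)
  have "[:poly (pCons c \<theta>) x:] - pCons c \<theta> \<circ>\<^sub>p [:x, a:] =
      [:x:] * ([:poly \<theta> x:] - \<theta> \<circ>\<^sub>p [:x, a:]) - [:a:] * ([:0, 1:] * (\<theta> \<circ>\<^sub>p [:x, a:]))"
    by (simp add: pcompose_pCons algebra_simps)
  then show ?case using pCons.IH by (metis dvd_diff dvd_mult dvd_triv_left)
qed simp

text \<open>
  The candidate action moves \<open>x\<^sub>i\<close> to \<open>x\<^sub>i + aT\<close> and is chosen so that every
  \<open>a x\<^sub>j + \<theta>\<^sub>j(x\<^sub>i)\<close> becomes invariant.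
\<close>

definition shear_hom ::
  "'n \<Rightarrow> ('n, 'a::comm_ring_1) mpoly \<Rightarrow> ('n \<Rightarrow> ('n, 'a) mpoly poly) \<Rightarrow>
    (('n, 'a) mpoly \<Rightarrow> ('n, 'a) mpoly poly) \<Rightarrow> bool" where
  "shear_hom i a \<theta> E \<longleftrightarrow> comm_ring_hom E \<and> (\<forall>c. E (Const c) = [:Const c:]) \<and> E (Var i) = [:Var i, a:] \<and>
    (\<forall>j. j \<noteq> i \<longrightarrow> [:a:] * (E (Var j) - [:Var j:]) = [:poly (\<theta> j) (Var i):] - \<theta> j \<circ>\<^sub>p [:Var i, a:])"

lemma shear_hom_exists:
  fixes \<theta> :: "'n::finite \<Rightarrow> ('n, 'a::comm_ring_1) mpoly poly"
  obtains E where "shear_hom i a \<theta> E"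
proof -
  have "\<exists>q. [:poly (\<theta> j) (Var i):] - \<theta> j \<circ>\<^sub>p [:Var i, a:] = [:a:] * q" for j
    using pcompose_shift_dvd[of a "\<theta> j" "Var i"] by (simp add: dvd_def)
  then obtain q where q: "\<And>j. [:poly (\<theta> j) (Var i):] - \<theta> j \<circ>\<^sub>p [:Var i, a:] = [:a:] * q j"
    by metis
  let ?E = "mpoly_eval (\<lambda>c. [:Const c:]) (\<lambda>j. if j = i then [:Var i, a:] else [:Var j:] + q j)"
  have "shear_hom i a \<theta> ?E"
    unfolding shear_hom_def q
    by (simp add: mpoly_eval_hom mpoly_eval_Const mpoly_eval_Var const_poly_Const_hom)
  then show thesis by (rule that)
qed

text \<open>With invariant coefficients, \<open>E\<close> sends \<open>\<theta>(x)\<close> to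
  \<open>\<theta>(x + aT)\<close>, which is exactly compensated by the prescribed change of
  \<open>a * Var j\<close>.\<close>

lemma shear_hom_invariant:
  assumes E: "shear_hom i a \<theta> E" and a: "E a = [:a:]" and "j \<noteq> i" "\<And>k. E (coeff (\<theta> j) k) = [:coeff (\<theta> j) k:]"
  shows "E (a * Var j + poly (\<theta> j) (Var i)) = [:a * Var j + poly (\<theta> j) (Var i):]"
proof -
  interpret comm_ring_hom E using E by (simp add: shear_hom_def)
  have "map_poly E (\<theta> j) = map_poly (\<lambda>c. [:c:]) (\<theta> j)"
    using assms(4) by (intro poly_eqI) (simp add: coeff_map_poly)
  then have "E (poly (\<theta> j) (Var i)) = \<theta> j \<circ>\<^sub>p [:Var i, a:]"
    using E by (simp add: pcompose_altdef shear_hom_def hom_poly[OF comm_ring_hom_axioms])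
  moreover have "[:a:] * (E (Var j) - [:Var j:]) = [:poly (\<theta> j) (Var i):] - \<theta> j \<circ>\<^sub>p [:Var i, a:]"
    using E \<open>j \<noteq> i\<close> by (simp add: shear_hom_def)
  then have "[:a:] * E (Var j) = [:a * Var j:] + [:poly (\<theta> j) (Var i):] - \<theta> j \<circ>\<^sub>p [:Var i, a:]"
    by (simp add: algebra_simps)
  ultimately show ?thesis
    by (simp add: hom_add hom_mult a)
qed

text \<open>The axioms hold at \<open>Var i\<close> by linearity and at
  \<open>a * Var j + \<theta>(Var i)\<close> by invariance, hence at \<open>a * Var j\<close> by
  subtraction and at \<open>Var j\<close> by cancellation.\<close>

lemma shear_hom_exponential:
  fixes \<sigma> :: "('n::{finite,linorder}, 'a::idom) mpoly \<Rightarrow> ('n, 'a) mpoly"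
  assumes E: "shear_hom i a \<theta> E"
    and a: "a \<noteq> 0" "E a = [:a:]" and \<theta>: "\<And>j k. j \<noteq> i \<Longrightarrow> E (coeff (\<theta> j) k) = [:coeff (\<theta> j) k:]"
    and \<sigma>: "comm_ring_hom \<sigma>" "\<And>c. \<sigma> (Const c) = Const c" "\<sigma> (Var i) = Var i + a"
    and \<sigma>\<theta>: "\<And>j. j \<noteq> i \<Longrightarrow> a * (\<sigma> (Var j) - Var j) = poly (\<theta> j) (Var i) - poly (\<theta> j) (Var i + a)"
  shows "exponential_over (range Const) \<sigma>"
proof -
  have hom: "comm_ring_hom E" and E_Const: "\<And>c. E (Const c) = [:Const c:]" and E_i: "E (Var i) = [:Var i, a:]"
    using E by (simp_all add: shear_hom_def)
  interpret comm_ring_hom E by fact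
  note S = is_subring_Ga_at[OF hom]
  have Ga_i: "Ga_at E (Var i)" using Ga_at_linear[OF hom E_i a(2)] .
  have Ga_Var: "Ga_at E (Var j)" for j
  proof (cases "j = i")
    case False
    let ?t = "poly (\<theta> j) (Var i)"
    have "Ga_at E (a * Var j + ?t)"
      using shear_hom_invariant[OF E a(2) False \<theta>[OF False]] Ga_at_invariant[OF hom] by blast
    moreover have "Ga_at E ?t"
      using Ga_at_poly[OF hom Ga_i] Ga_at_invariant[OF hom \<theta>[OF False]] by blast
    ultimately have "Ga_at E (a * Var j)"
      using is_subring_diff[OF S, of "a * Var j + ?t" ?t] by simp
    then show ?thesis by (rule Ga_at_cancel[OF hom a(2,1)])
  qed (use Ga_i in simp)
  have "Ga_at E b" for b
    using is_subring_mpoly[OF S, of b] Ga_Var Ga_at_invariant[OF hom E_Const] by simp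
  then have "Ga_action E" by (rule Ga_actionI[OF hom])
  moreover have "\<sigma> b = poly (E b) 1" for b
  proof (rule mpoly_hom_cong[OF \<sigma>(1) comm_ring_hom_comp[OF poly_eval_hom hom]])
    show "\<sigma> (Const c) = poly (E (Const c)) 1" for c by (simp add: \<sigma>(2) E_Const)
    show "\<sigma> (Var j) = poly (E (Var j)) 1" for j
    proof (cases "j = i")
      case False
      have "[:a:] * (E (Var j) - [:Var j:]) = [:poly (\<theta> j) (Var i):] - \<theta> j \<circ>\<^sub>p [:Var i, a:]"
        using E False by (simp add: shear_hom_def)
      \<comment> \<open>At \<open>T = 1\<close> the relation defining \<open>E\<close> becomes the
        relation assumed for \<open>\<sigma>\<close>.\<close>
      from arg_cong[OF this, of "\<lambda>q. poly q 1"]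
      have "a * (poly (E (Var j)) 1 - Var j) = a * (\<sigma> (Var j) - Var j)"
        by (simp add: \<sigma>\<theta>[OF False] poly_pcompose)
      then show ?thesis using a(1) by simp
    qed (simp add: \<sigma>(3) E_i)
  qed
  then have "\<sigma> = Ga_specialize E 1" by (auto simp: Ga_specialize_def)
  moreover have "1 \<in> Ga_invariants E" "range Const \<subseteq> Ga_invariants E"
    by (auto simp: Ga_invariants_def E_Const one_pCons)
  ultimately show ?thesis unfolding exponential_over_def by blast
qed

section \<open>Triangular automorphisms of order \<open>p\<close>\<close>

text \<open>Read as a polynomial in \<open>Var i\<close>, \<open>f\<close> has coefficients in the
  variables of \<open>V\<close>, which \<open>\<sigma>\<close> fixes. So \<open>\<sigma>\<close>
  acts on it as the shift by \<open>a\<close>, and Hilbert 90 applies with \<open>S\<close> the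
  polynomials in \<open>V\<close>.\<close>

lemma trace_zero_imp_shift_difference:
  fixes \<sigma> :: "('n::{finite,linorder}, 'a::idom) mpoly \<Rightarrow> ('n, 'a) mpoly"
  assumes p: "prime p" "CHAR('a) = p"
    and \<sigma>: "comm_ring_hom \<sigma>" "\<And>c. \<sigma> (Const c) = Const c" "\<And>k. k \<in> V \<Longrightarrow> \<sigma> (Var k) = Var k"
    and i: "i \<notin> V" "\<sigma> (Var i) = Var i + a" and a: "vars a \<subseteq> V" "a \<noteq> 0"
    and f: "vars f \<subseteq> insert i V" and tr: "(\<Sum>k<p. (\<sigma> ^^ k) f) = 0"
  obtains \<theta> where "\<And>k. vars (coeff \<theta> k) \<subseteq> V" "\<And>k. p dvd k \<Longrightarrow> coeff \<theta> k = 0"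
    "a * f = poly \<theta> (Var i) - poly \<theta> (Var i + a)"
proof -
  define g where "g = as_poly_in i f"
  define S where "S = {q :: ('n, 'a) mpoly. vars q \<subseteq> V}"
  have S: "is_subring S" unfolding S_def by (rule is_subring_vars)
  interpret \<sigma>: comm_ring_hom \<sigma> by fact
  interpret I: comm_ring_hom "as_poly_in i :: ('n, 'a) mpoly \<Rightarrow> _" by (rule as_poly_in_hom)
  have gS: "coeff g k \<in> S" for k
    using vars_coeff_as_poly_in[of i f k] f by (auto simp: g_def S_def)
  have \<sigma>S: "\<sigma> q = q" if "q \<in> S" for q
    by (rule mpoly_hom_cong[OF \<sigma>(1) id_hom]) (use \<sigma> that in \<open>auto simp: S_def\<close>)
  have IS: "as_poly_in i q = [:q:]" if "q \<in> S" for q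
    using that i(1) by (intro as_poly_in_const) (auto simp: S_def)
  have aS: "of_nat k * a \<in> S" for k
    using a(1) by (intro is_subring_mult[OF S] is_subring_of_nat[OF S]) (simp add: S_def)
  have map_\<sigma>: "map_poly \<sigma> g = g"
    by (intro poly_eqI) (simp add: coeff_map_poly \<sigma>S[OF gS])
  have map_I: "map_poly (as_poly_in i) g = map_poly (\<lambda>c. [:c:]) g"
    by (intro poly_eqI) (simp add: coeff_map_poly IS[OF gS])
  have iter: "(\<sigma> ^^ k) f = poly g (Var i + of_nat k * a)" for k
  proof (induction k)
    case 0
    then show ?case by (simp add: g_def poly_as_poly_in)
  next
    case (Suc k)
    have "(\<sigma> ^^ Suc k) f = poly (map_poly \<sigma> g) (\<sigma> (Var i + of_nat k * a))"
      unfolding funpow.simps comp_apply Suc by (rule hom_poly[OF \<sigma>(1)])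
    also have "\<sigma> (Var i + of_nat k * a) = Var i + of_nat (Suc k) * a"
      unfolding \<sigma>.hom_add i(2) \<sigma>S[OF aS] by (simp add: algebra_simps)
    finally show ?case unfolding map_\<sigma> .
  qed
  have "as_poly_in i ((\<sigma> ^^ k) f) = g \<circ>\<^sub>p [:of_nat k * a, 1:]" for k
  proof -
    have "as_poly_in i (Var i + of_nat k * a) = [:of_nat k * a, 1:]"
      unfolding I.hom_add IS[OF aS] by (simp add: as_poly_in_Var)
    then show ?thesis
      unfolding iter hom_poly[OF as_poly_in_hom] map_I pcompose_altdef by (rule arg_cong)
  qed
  then have "(\<Sum>k<p. g \<circ>\<^sub>p [:of_nat k * a, 1:]) = as_poly_in i (\<Sum>k<p. (\<sigma> ^^ k) f)"
    by (simp add: I.hom_sum)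
  then have tr_g: "(\<Sum>k<p. g \<circ>\<^sub>p [:of_nat k * a, 1:]) = 0"
    unfolding tr by simp
  have "CHAR(('n, 'a) mpoly) = p" "a \<in> S"
    using p(2) aS[of 1] by (simp_all add: CHAR_mpoly)
  then obtain \<theta> where \<theta>: "\<And>k. coeff \<theta> k \<in> S" "\<And>k. p dvd k \<Longrightarrow> coeff \<theta> k = 0"
      "smult a g = \<theta> - \<theta> \<circ>\<^sub>p [:a, 1:]"
    using additive_hilbert_90_shift[OF p(1) _ S _ a(2) gS tr_g] by blast
  have "a * f = poly \<theta> (Var i) - poly \<theta> (Var i + a)"
    using arg_cong[OF \<theta>(3), of "\<lambda>q. poly q (Var i)"]
    by (simp add: poly_pcompose g_def poly_as_poly_in add.commute)
  moreover have "vars (coeff \<theta> k) \<subseteq> V" for k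
    using \<theta>(1)[of k] by (simp add: S_def)
  ultimately show thesis using that \<theta>(2) by blast
qed

lemma funpow_shift:
  assumes "comm_ring_hom \<sigma>" "\<sigma> y = y + f"
  shows "(\<sigma> ^^ n) y = y + (\<Sum>k<n. (\<sigma> ^^ k) f)"
proof -
  interpret comm_ring_hom \<sigma> by fact
  show ?thesis
  proof (induction n)
    case (Suc n)
    have "(\<sigma> ^^ Suc n) y = y + (f + (\<Sum>k<n. (\<sigma> ^^ Suc k) f))"
      by (simp add: Suc hom_add hom_sum assms(2) add.assoc)
    also have "f + (\<Sum>k<n. (\<sigma> ^^ Suc k) f) = (\<Sum>k<Suc n. (\<sigma> ^^ k) f)"
      unfolding sum.lessThan_Suc_shift by simp
    finally show ?case .
  qed simp
qed

text \<open>The \<open>p\<close>-th iterate adds the trace of \<open>f\<close> to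
  \<open>y\<close>.\<close>

lemma trace_eq_0:
  fixes y :: "'b::comm_ring_1"
  assumes "comm_ring_hom \<sigma>" "\<sigma> y = y + f" "\<sigma> ^^ p = id"
  shows "(\<Sum>k<p. (\<sigma> ^^ k) f) = 0"
  using funpow_shift[OF assms(1,2), of p] assms(3) by simp

text \<open>The coefficient of \<open>Var i\<close> in its \<open>p\<close>-th iterate is
  \<open>u^p\<close>, so \<open>u^p = 1\<close>.\<close>

lemma triangular_unipotent:
  fixes \<sigma> :: "('n::{finite,linorder}, 'a::idom) mpoly \<Rightarrow> ('n, 'a) mpoly"
  assumes p: "prime p" "CHAR('a) = p" and \<sigma>: "\<sigma> \<in> triangular_automorphisms" "\<sigma> ^^ p = id"
  obtains f where "vars f \<subseteq> {..<i}" "\<sigma> (Var i) = Var i + f"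
proof -
  interpret \<sigma>: comm_ring_hom \<sigma>
    using \<sigma>(1) unfolding triangular_automorphisms_def algebra_automorphism_def by blast
  have \<sigma>_Const: "\<sigma> (Const c) = Const c" for c
    using \<sigma>(1) unfolding triangular_automorphisms_def algebra_automorphism_def by blast
  have tri: "\<exists>u f. vars f \<subseteq> {..<j} \<and> \<sigma> (Var j) = Const u * Var j + f" for j
    using \<sigma>(1) unfolding triangular_automorphisms_def by blast
  note S = is_subring_vars[of "{..<i}", where 'a = 'a]
  \<comment> \<open>Lower variables are mapped to polynomials in lower variables, so the remainder
    stays below \<open>i\<close> under iteration.\<close>
  have stable: "vars (\<sigma> h) \<subseteq> {..<i}" if h: "vars h \<subseteq> {..<i}" for h
  proof (rule vars_hom[OF \<sigma>.comm_ring_hom_axioms])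
    show "vars (\<sigma> (Const c)) \<subseteq> {..<i}" for c by (simp add: \<sigma>_Const)
    fix j assume "j \<in> vars h"
    then have "j < i" using h by auto
    obtain u f where f: "vars f \<subseteq> {..<j}" "\<sigma> (Var j) = Const u * Var j + f" using tri by blast
    have "Const u \<in> {q. vars q \<subseteq> {..<i}}" "Var j \<in> {q :: ('n, 'a) mpoly. vars q \<subseteq> {..<i}}"
        "f \<in> {q. vars q \<subseteq> {..<i}}"
      using f(1) \<open>j < i\<close> by auto
    then have "Const u * Var j + f \<in> {q. vars q \<subseteq> {..<i}}"
      by (intro is_subring_add[OF S] is_subring_mult[OF S])
    then show "vars (\<sigma> (Var j)) \<subseteq> {..<i}" by (simp add: f(2))
  qed
  obtain u f where f: "vars f \<subseteq> {..<i}" "\<sigma> (Var i) = Const u * Var i + f" using tri by blast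
  have "\<exists>h. vars h \<subseteq> {..<i} \<and> (\<sigma> ^^ k) (Var i) = Const (u ^ k) * Var i + h" for k
  proof (induction k)
    case 0
    then show ?case by (intro exI[of _ 0]) simp
  next
    case (Suc k)
    then obtain h where h: "vars h \<subseteq> {..<i}" "(\<sigma> ^^ k) (Var i) = Const (u ^ k) * Var i + h" by blast
    have "Const (u ^ k) \<in> {q. vars q \<subseteq> {..<i}}" "f \<in> {q. vars q \<subseteq> {..<i}}" "\<sigma> h \<in> {q. vars q \<subseteq> {..<i}}"
      using f(1) stable[OF h(1)] by simp_all
    then have "Const (u ^ k) * f + \<sigma> h \<in> {q. vars q \<subseteq> {..<i}}"
      by (intro is_subring_add[OF S] is_subring_mult[OF S])
    moreover have "(\<sigma> ^^ Suc k) (Var i) = Const (u ^ Suc k) * Var i + (Const (u ^ k) * f + \<sigma> h)"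
      by (simp add: h(2) f(2) \<sigma>.hom_add \<sigma>.hom_mult \<sigma>_Const Const.hom_mult algebra_simps)
    ultimately show ?case by blast
  qed
  then obtain h where h: "vars h \<subseteq> {..<i}" "(\<sigma> ^^ p) (Var i) = Const (u ^ p) * Var i + h" by blast
  interpret I: comm_ring_hom "as_poly_in i :: ('n, 'a) mpoly \<Rightarrow> _" by (rule as_poly_in_hom)
  have "i \<notin> vars h" using h(1) by auto
  then have "[:0, 1:] = [:h, Const (u ^ p):]"
    using arg_cong[OF h(2), of "as_poly_in i"] \<sigma>(2)
    by (simp add: I.hom_add I.hom_mult as_poly_in_Var as_poly_in_const)
  then have "u ^ p = 1" by (simp add: Const.hom_1_iff)
  \<comment> \<open>The freshman's dream gives \<open>u^p = (u-1)^p + 1\<close>; thus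
    \<open>(u-1)^p = 0\<close>, and \<open>u = 1\<close> in a domain.\<close>
  moreover have "(u - 1 + 1) ^ p = (u - 1) ^ p + 1 ^ p"
    by (rule freshmans_dream) (use p in simp_all)
  ultimately have "u = 1" by simp
  then show thesis using f that by simp
qed

section \<open>Actions realising \<open>\<sigma>\<close>, by the number of moving variables\<close>

lemma shear_hom_fixes:
  fixes a :: "('n::{finite,linorder}, 'a::idom) mpoly"
  assumes "shear_hom i a \<theta> E" "a \<noteq> 0" "k \<noteq> i" "\<theta> k = 0"
  shows "E (Var k) = [:Var k:]"
proof -
  have "[:a:] * (E (Var k) - [:Var k:]) = [:poly (\<theta> k) (Var i):] - \<theta> k \<circ>\<^sub>p [:Var i, a:]"
    using assms(1,3) unfolding shear_hom_def by blast
  then show ?thesis using assms(2,4) by simp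
qed

text \<open>The translation of \<open>Var j\<close> by \<open>fT\<close> is the action:
  \<open>f\<close> is invariant because it avoids \<open>Var j\<close>. All \<open>\<theta>\<close>
  are zero.\<close>

lemma exponential_one_variable:
  fixes \<sigma> :: "('n::{finite,linorder}, 'a::idom) mpoly \<Rightarrow> ('n, 'a) mpoly"
  assumes \<sigma>: "comm_ring_hom \<sigma>" "\<And>c. \<sigma> (Const c) = Const c" "\<And>k. k \<noteq> j \<Longrightarrow> \<sigma> (Var k) = Var k"
    and j: "\<sigma> (Var j) = Var j + f" "f \<noteq> 0" "j \<notin> vars f"
  shows "exponential_over (range Const) \<sigma>"
proof -
  obtain E where E: "shear_hom j f (\<lambda>_. 0) E" by (rule shear_hom_exists)
  have hom: "comm_ring_hom E" and E_Const: "\<And>c. E (Const c) = [:Const c:]"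
    using E by (simp_all add: shear_hom_def)
  have E_Var: "E (Var k) = [:Var k:]" if "k \<noteq> j" for k
    using shear_hom_fixes[OF E j(2) that] by simp
  have "E f = [:f:]"
    by (rule mpoly_hom_cong[OF hom const_poly_hom E_Const E_Var]) (use j(3) in auto)
  from shear_hom_exponential[OF E j(2) this _ \<sigma>(1,2) j(1)] show ?thesis
    using E_Const[of 0] by (simp add: \<sigma>(3))
qed

text \<open>The variables other than \<open>i\<close> and \<open>j\<close> serve as coefficients,
  fixed by both \<open>\<sigma>\<close> and \<open>E\<close>. This covers two variables with
  constant \<open>a\<close> and three variables with the first one fixed.\<close>

lemma exponential_two_variables:
  fixes \<sigma> :: "('n::{finite,linorder}, 'a::idom) mpoly \<Rightarrow> ('n, 'a) mpoly"
  assumes p: "prime p" "CHAR('a) = p" "\<sigma> ^^ p = id"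
    and \<sigma>: "comm_ring_hom \<sigma>" "\<And>c. \<sigma> (Const c) = Const c" "\<And>k. k \<noteq> i \<Longrightarrow> k \<noteq> j \<Longrightarrow> \<sigma> (Var k) = Var k"
    and i: "\<sigma> (Var i) = Var i + a" "a \<noteq> 0" "vars a \<subseteq> - {i, j}"
    and j: "j \<noteq> i" "\<sigma> (Var j) = Var j + f" "vars f \<subseteq> - {j}"
  shows "exponential_over (range Const) \<sigma>"
proof -
  obtain \<theta> where \<theta>: "\<And>k. vars (coeff \<theta> k) \<subseteq> - {i, j}" "a * f = poly \<theta> (Var i) - poly \<theta> (Var i + a)"
    by (rule trace_zero_imp_shift_difference[OF p(1,2) \<sigma>(1,2) _ _ i(1,3,2) _ trace_eq_0[OF \<sigma>(1) j(2) p(3)]])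
      (use \<sigma>(3) j in auto)
  define \<Theta> where "\<Theta> = (\<lambda>k. if k = j then \<theta> else 0)"
  obtain E where E: "shear_hom i a \<Theta> E" by (rule shear_hom_exists)
  have hom: "comm_ring_hom E" and E_Const: "\<And>c. E (Const c) = [:Const c:]"
    using E by (simp_all add: shear_hom_def)
  have E_Var: "E (Var k) = [:Var k:]" if "k \<noteq> i" "k \<noteq> j" for k
    using shear_hom_fixes[OF E i(2) that(1)] that(2) by (simp add: \<Theta>_def)
  have inv: "E q = [:q:]" if "vars q \<subseteq> - {i, j}" for q
    by (rule mpoly_hom_cong[OF hom const_poly_hom E_Const E_Var]) (use that in auto)
  show ?thesis
  proof (rule shear_hom_exponential[OF E i(2) inv[OF i(3)] _ \<sigma>(1,2) i(1)])
    show "E (coeff (\<Theta> k) l) = [:coeff (\<Theta> k) l:]" for k l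
      using inv[OF \<theta>(1)] E_Const[of 0] by (simp add: \<Theta>_def)
    show "a * (\<sigma> (Var k) - Var k) = poly (\<Theta> k) (Var i) - poly (\<Theta> k) (Var i + a)" if "k \<noteq> i" for k
      using that j(2) \<sigma>(3) \<theta>(2) by (simp add: \<Theta>_def)
  qed
qed

text \<open>
  Conjugation by \<open>\<tau>\<close>, which makes the invariant \<open>a x\<^sub>j + \<theta>(x\<^sub>i)\<close> a variable,
  reduces the last variable to the case of two moving variables; \<open>\<tau>\<close> is invertible
  because \<open>a\<close> is a unit.
\<close>

lemma exponential_three_variables:
  fixes \<sigma> :: "('n::{finite,linorder}, 'a::idom) mpoly \<Rightarrow> ('n, 'a) mpoly"
  assumes p: "prime p" "CHAR('a) = p" "\<sigma> ^^ p = id"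
    and \<sigma>: "comm_ring_hom \<sigma>" "\<And>c. \<sigma> (Const c) = Const c"
    and ijk: "i \<noteq> j" "i \<noteq> k" "j \<noteq> k" "UNIV = {i, j, k}"
    and i: "\<sigma> (Var i) = Var i + Const c" "c dvd 1"
    and j: "\<sigma> (Var j) = Var j + f" "vars f \<subseteq> {i}"
    and k: "\<sigma> (Var k) = Var k + g" "vars g \<subseteq> {i, j}"
  shows "exponential_over (range Const) \<sigma>"
proof -
  obtain d where d: "c * d = 1" using i(2) by (metis dvdE)
  then have "c \<noteq> 0" by auto
  then have a0: "(Const c :: ('n, 'a) mpoly) \<noteq> 0" by simp
  have dc: "Const d * Const c = (1 :: ('n, 'a) mpoly)" "Const c * Const d = (1 :: ('n, 'a) mpoly)"
    using d by (simp_all add: mult.commute flip: Const.hom_mult)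
  interpret \<sigma>: comm_ring_hom \<sigma> by fact
  obtain \<theta> where \<theta>: "\<And>l. vars (coeff \<theta> l) \<subseteq> {}"
      "Const c * f = poly \<theta> (Var i) - poly \<theta> (Var i + Const c)"
    by (rule trace_zero_imp_shift_difference[OF p(1,2) \<sigma>(1,2) _ _ i(1) _ a0 _ trace_eq_0[OF \<sigma>(1) j(1) p(3)],
          where V = "{}"]) (use j in auto)
  define t where "t = poly \<theta> (Var i)"
  have vars_t: "vars t \<subseteq> {i}"
    unfolding t_def using \<theta>(1) by (intro vars_poly) auto
  define \<tau> where "\<tau> = mpoly_eval Const (\<lambda>l. if l = j then Const c * Var j + t else Var l)"
  \<comment> \<open>The inverse of \<open>\<tau>\<close>, obtained by solving \<open>c x + t\<close>
    for \<open>x\<close> with \<open>d = 1/c\<close>.\<close>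
  define \<tau>' where "\<tau>' = mpoly_eval Const (\<lambda>l. if l = j then Const d * (Var j - t) else Var l)"
  note CH = Const.comm_ring_hom_axioms
  have \<tau>_hom: "comm_ring_hom \<tau>" and \<tau>_Const: "\<tau> (Const b) = Const b"
    and \<tau>_Var: "\<tau> (Var l) = (if l = j then Const c * Var j + t else Var l)" for b l
    unfolding \<tau>_def by (simp_all add: mpoly_eval_hom[OF CH] mpoly_eval_Const[OF CH] mpoly_eval_Var[OF CH])
  have \<tau>'_hom: "comm_ring_hom \<tau>'" and \<tau>'_Const: "\<tau>' (Const b) = Const b"
    and \<tau>'_Var: "\<tau>' (Var l) = (if l = j then Const d * (Var j - t) else Var l)" for b l
    unfolding \<tau>'_def by (simp_all add: mpoly_eval_hom[OF CH] mpoly_eval_Const[OF CH] mpoly_eval_Var[OF CH])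
  interpret \<tau>: comm_ring_hom \<tau> by fact
  interpret \<tau>': comm_ring_hom \<tau>' by fact
  have \<tau>_t: "\<tau> t = t"
    by (rule mpoly_hom_cong[OF \<tau>_hom id_hom \<tau>_Const]) (use vars_t ijk(1) in \<open>auto simp: \<tau>_Var\<close>)
  have \<tau>'_t: "\<tau>' t = t"
    by (rule mpoly_hom_cong[OF \<tau>'_hom id_hom \<tau>'_Const]) (use vars_t ijk(1) in \<open>auto simp: \<tau>'_Var\<close>)
  have \<tau>\<tau>': "\<tau> (\<tau>' q) = q" for q
  proof (rule mpoly_hom_cong[OF comm_ring_hom_comp[OF \<tau>_hom \<tau>'_hom] id_hom])
    show "\<tau> (\<tau>' (Var l)) = Var l" for l
      using dc by (simp add: \<tau>'_Var \<tau>_Var \<tau>_Const \<tau>_t \<tau>.hom_mult \<tau>.hom_minus flip: mult.assoc)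
  qed (simp add: \<tau>_Const \<tau>'_Const)
  have \<tau>'\<tau>: "\<tau>' (\<tau> q) = q" for q
  proof (rule mpoly_hom_cong[OF comm_ring_hom_comp[OF \<tau>'_hom \<tau>_hom] id_hom])
    show "\<tau>' (\<tau> (Var l)) = Var l" for l
      using dc by (simp add: \<tau>'_Var \<tau>_Var \<tau>'_Const \<tau>'_t \<tau>'.hom_mult \<tau>'.hom_add flip: mult.assoc)
  qed (simp add: \<tau>_Const \<tau>'_Const)

  \<comment> \<open>In the new coordinates \<open>Var i\<close> is still shifted by \<open>c\<close>
    while \<open>Var j\<close> is fixed, so Hilbert 90 applies to \<open>\<tau>' g\<close> over the
    polynomials in \<open>Var j\<close>.\<close>
  define \<rho> where "\<rho> = (\<lambda>q. \<tau>' (\<sigma> (\<tau> q)))"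
  have \<rho>_hom: "comm_ring_hom \<rho>"
    unfolding \<rho>_def by (rule comm_ring_hom_comp[OF \<tau>'_hom comm_ring_hom_comp[OF \<sigma>(1) \<tau>_hom]])
  have \<rho>_Const: "\<rho> (Const b) = Const b" for b by (simp add: \<rho>_def \<tau>_Const \<tau>'_Const \<sigma>(2))
  have \<rho>_i: "\<rho> (Var i) = Var i + Const c"
    using ijk(1) by (simp add: \<rho>_def \<tau>_Var i(1) \<tau>'.hom_add \<tau>'_Var \<tau>'_Const)
  have \<sigma>_t: "\<sigma> t = poly \<theta> (Var i + Const c)"
  proof -
    have "\<sigma> (coeff \<theta> l) = coeff \<theta> l" for l
      using \<theta>(1)[of l] vars_empty_iff[of "coeff \<theta> l"] \<sigma>(2) by auto
    then have "map_poly \<sigma> \<theta> = \<theta>" by (intro poly_eqI) (simp add: coeff_map_poly)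
    then show ?thesis unfolding t_def hom_poly[OF \<sigma>(1)] i(1) by (simp only:)
  qed
  have \<rho>_j: "\<rho> (Var j) = Var j"
  proof -
    have "\<sigma> (\<tau> (Var j)) = Const c * Var j + Const c * f + \<sigma> t"
      by (simp add: \<tau>_Var \<sigma>.hom_add \<sigma>.hom_mult \<sigma>(2) j(1) distrib_left)
    also have "\<dots> = \<tau> (Var j)"
      unfolding \<theta>(2) \<sigma>_t by (simp add: \<tau>_Var t_def)
    finally show ?thesis by (simp add: \<rho>_def \<tau>'\<tau>)
  qed
  have \<rho>_pow: "(\<rho> ^^ l) (\<tau>' g) = \<tau>' ((\<sigma> ^^ l) g)" for l
    by (induction l) (simp_all add: \<rho>_def \<tau>\<tau>')
  have "(\<Sum>l<p. (\<rho> ^^ l) (\<tau>' g)) = \<tau>' (\<Sum>l<p. (\<sigma> ^^ l) g)"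
    unfolding \<rho>_pow \<tau>'.hom_sum ..
  then have tr: "(\<Sum>l<p. (\<rho> ^^ l) (\<tau>' g)) = 0"
    unfolding trace_eq_0[OF \<sigma>(1) k(1) p(3)] by simp
  have vars_\<tau>'g: "vars (\<tau>' g) \<subseteq> insert i {j}"
  proof (rule vars_hom[OF \<tau>'_hom])
    show "vars (\<tau>' (Const b)) \<subseteq> insert i {j}" for b by (simp add: \<tau>'_Const)
    show "vars (\<tau>' (Var l)) \<subseteq> insert i {j}" if "l \<in> vars g" for l
      using that k(2) vars_t vars_mult[of "Const d" "Var j - t"] vars_diff[of "Var j" t]
      by (auto simp: \<tau>'_Var)
  qed
  obtain \<eta> where \<eta>: "\<And>l. vars (coeff \<eta> l) \<subseteq> {j}"
      "Const c * \<tau>' g = poly \<eta> (Var i) - poly \<eta> (Var i + Const c)"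
    by (rule trace_zero_imp_shift_difference[OF p(1,2) \<rho>_hom \<rho>_Const _ _ \<rho>_i _ a0 vars_\<tau>'g tr])
      (use \<rho>_j ijk(1) in auto)
  \<comment> \<open>Carried back by \<open>\<tau>\<close>, the coefficients of \<open>\<eta>\<close>
    become polynomials in the invariant \<open>\<tau> (Var j)\<close>.\<close>
  define \<Theta> where "\<Theta> = (\<lambda>l. if l = j then \<theta> else map_poly \<tau> \<eta>)"
  have \<Theta>_k: "Const c * g = poly (\<Theta> k) (Var i) - poly (\<Theta> k) (Var i + Const c)"
  proof -
    have "Const c * g = \<tau> (Const c * \<tau>' g)" by (simp add: \<tau>.hom_mult \<tau>_Const \<tau>\<tau>')
    also have "\<dots> = poly (map_poly \<tau> \<eta>) (\<tau> (Var i)) - poly (map_poly \<tau> \<eta>) (\<tau> (Var i + Const c))"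
      unfolding \<eta>(2) \<tau>.hom_minus hom_poly[OF \<tau>_hom] ..
    also have "\<tau> (Var i + Const c) = Var i + Const c"
      using ijk(1) by (simp add: \<tau>.hom_add \<tau>_Var \<tau>_Const)
    also have "\<tau> (Var i) = Var i"
      using ijk(1) by (simp add: \<tau>_Var)
    finally show ?thesis using ijk(3) by (simp add: \<Theta>_def)
  qed

  obtain E where E: "shear_hom i (Const c) \<Theta> E" by (rule shear_hom_exists)
  have E_hom: "comm_ring_hom E" and E_Const: "\<And>b. E (Const b) = [:Const b:]"
    using E by (simp_all add: shear_hom_def)
  interpret E: comm_ring_hom E by fact
  \<comment> \<open>Invariance comes in two stages: constant coefficients for \<open>j\<close> make
    \<open>\<tau> (Var j)\<close> invariant, and then so are the coefficients for
    \<open>k\<close>.\<close>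
  have E_\<theta>: "E (coeff (\<Theta> j) l) = [:coeff (\<Theta> j) l:]" for l
    using \<theta>(1)[of l] vars_empty_iff[of "coeff \<theta> l"] E_Const by (auto simp: \<Theta>_def)
  have E_\<tau>j: "E (\<tau> (Var j)) = [:\<tau> (Var j):]"
    using shear_hom_invariant[OF E E_Const ijk(1)[symmetric] E_\<theta>] by (simp add: \<tau>_Var t_def \<Theta>_def)
  have "E (\<tau> q) = [:\<tau> q:]" if "vars q \<subseteq> {j}" for q
    by (rule mpoly_hom_cong[OF comm_ring_hom_comp[OF E_hom \<tau>_hom] comm_ring_hom_comp[OF const_poly_hom \<tau>_hom]])
      (use that E_\<tau>j in \<open>auto simp: \<tau>_Const E_Const\<close>)
  then have E_\<Theta>: "E (coeff (\<Theta> l) m) = [:coeff (\<Theta> l) m:]" for l m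
    using E_\<theta>[of m] \<eta>(1)[of m] by (cases "l = j") (auto simp: \<Theta>_def coeff_map_poly)
  show ?thesis
  proof (rule shear_hom_exponential[OF E a0 E_Const E_\<Theta> \<sigma> i(1)])
    show "Const c * (\<sigma> (Var l) - Var l) = poly (\<Theta> l) (Var i) - poly (\<Theta> l) (Var i + Const c)" if "l \<noteq> i" for l
    proof -
      have "l = j \<or> l = k" using that ijk(4) by blast
      then show ?thesis using \<Theta>_k \<theta>(2) k(1) j(1) by (auto simp: \<Theta>_def)
    qed
  qed
qed

section \<open>Coefficients in the field of fractions\<close>

lemma lookup_to_fract_mpoly:
  "Poly_Mapping.lookup (to_fract_mpoly f) m = to_fract (Poly_Mapping.lookup f m)"
  by (simp add: to_fract_mpoly_def Poly_Mapping.map.rep_eq when_def)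

lemma to_fract_mpoly_single:
  "to_fract_mpoly (Poly_Mapping.single m c) = Poly_Mapping.single m (to_fract c)"
  by (rule poly_mapping_eqI) (simp add: lookup_to_fract_mpoly lookup_single when_def)

lemma to_fract_mpoly_hom:
  "comm_ring_hom (to_fract_mpoly :: ('n, 'a::idom) mpoly \<Rightarrow> ('n, 'a fract) mpoly)"
proof (rule poly_mapping_ring_homI)
  show "to_fract_mpoly (f + g) = to_fract_mpoly f + to_fract_mpoly g" for f g :: "('n, 'a) mpoly"
    by (rule poly_mapping_eqI) (simp add: lookup_to_fract_mpoly lookup_add)
  show "to_fract_mpoly (1 :: ('n, 'a) mpoly) = 1"
    by (simp add: to_fract_mpoly_single flip: single_one)
qed (simp add: to_fract_mpoly_single mult_single)

lemma to_fract_mpoly_Const: "to_fract_mpoly (Const c) = Const (to_fract c)"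
  by (simp add: Const_def to_fract_mpoly_single)

lemma to_fract_mpoly_Var: "to_fract_mpoly (Var i) = Var i"
  by (simp add: Var_def to_fract_mpoly_single)

lemma subst_poly_eq_poly: "subst_poly \<theta> g = poly (map_poly Const \<theta>) g"
  by (simp add: subst_poly_def poly_altdef coeff_map_poly degree_map_poly)

text \<open>Hilbert 90 over the constants writes \<open>a f\<close> as a shift difference; the
  division by \<open>a\<close> takes place only in the field of fractions.\<close>

lemma two_variables_normal_form:
  fixes \<sigma> :: "('n::{finite,linorder}, 'a::idom) mpoly \<Rightarrow> ('n, 'a) mpoly"
  assumes p: "prime p" "CHAR('a) = p" "\<sigma> ^^ p = id"
    and \<sigma>: "comm_ring_hom \<sigma>" "\<And>c. \<sigma> (Const c) = Const c"
    and i: "\<sigma> (Var i) = Var i + Const a" "a \<noteq> 0"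
    and j: "\<sigma> (Var j) = Var j + f" "vars f \<subseteq> {i}"
  obtains \<theta> where "\<And>k. p dvd k \<Longrightarrow> coeff \<theta> k = 0"
    "to_fract_mpoly (\<sigma> (Var j)) = Var j + Const (inverse (to_fract a)) *
       to_fract_mpoly (subst_poly \<theta> (Var i) - subst_poly \<theta> (Var i + Const a))"
proof -
  have a0: "(Const a :: ('n, 'a) mpoly) \<noteq> 0" using i(2) by simp
  obtain \<eta> where \<eta>: "\<And>k. vars (coeff \<eta> k) \<subseteq> {}" "\<And>k. p dvd k \<Longrightarrow> coeff \<eta> k = 0"
      "Const a * f = poly \<eta> (Var i) - poly \<eta> (Var i + Const a)"
    by (rule trace_zero_imp_shift_difference[OF p(1,2) \<sigma>(1,2) _ _ i(1) _ a0 _ trace_eq_0[OF \<sigma>(1) j(1) p(3)],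
          where V = "{}"]) (use j in auto)
  have "\<exists>c. coeff \<eta> k = Const c" for k
    using \<eta>(1)[of k] vars_empty_iff[of "coeff \<eta> k"] by auto
  then obtain c where c: "\<And>k. coeff \<eta> k = Const (c k)" by metis
  \<comment> \<open>The coefficients of \<open>\<eta>\<close> contain no variable, so their entry at
    exponent \<open>0\<close> recovers them as ring elements.\<close>
  define \<theta> where "\<theta> = map_poly (\<lambda>q. Poly_Mapping.lookup q 0) \<eta>"
  have coeff_\<theta>: "coeff \<theta> k = c k" for k
    by (simp add: \<theta>_def coeff_map_poly c Const_def)
  have map_\<theta>: "map_poly Const \<theta> = \<eta>"
    by (intro poly_eqI) (simp add: coeff_map_poly coeff_\<theta> c)
  interpret F: comm_ring_hom "to_fract_mpoly :: ('n, 'a) mpoly \<Rightarrow> _" by (rule to_fract_mpoly_hom)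
  have "Const (inverse (to_fract a)) * to_fract_mpoly (subst_poly \<theta> (Var i) - subst_poly \<theta> (Var i + Const a))
      = Const (inverse (to_fract a)) * (Const (to_fract a) * to_fract_mpoly f)"
    unfolding subst_poly_eq_poly map_\<theta> \<eta>(3)[symmetric] F.hom_mult to_fract_mpoly_Const ..
  also have "\<dots> = Const (inverse (to_fract a) * to_fract a) * to_fract_mpoly f"
    by (simp only: Const.hom_mult mult.assoc)
  also have "\<dots> = to_fract_mpoly f"
    using i(2) by simp
  finally have "to_fract_mpoly (\<sigma> (Var j)) = Var j + Const (inverse (to_fract a)) *
      to_fract_mpoly (subst_poly \<theta> (Var i) - subst_poly \<theta> (Var i + Const a))"
    by (simp only: j(1) F.hom_add to_fract_mpoly_Var)
  moreover have "coeff \<theta> k = 0" if "p dvd k" for k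
    using \<eta>(2)[OF that] by (simp add: coeff_\<theta> c)
  ultimately show thesis using that by blast
qed

section \<open>Index types of two or three elements, and the final case distinctions\<close>

lemma UNIV_card_2:
  assumes "CARD('n::{finite,linorder}) = 2"
  shows "Min UNIV < (Max UNIV :: 'n)" "UNIV = {Min UNIV, Max UNIV :: 'n}"
proof -
  obtain x y :: 'n where xy: "UNIV = {x, y}" "x \<noteq> y"
    using assms card_2_iff[of "UNIV :: 'n set"] by auto
  show "Min UNIV < (Max UNIV :: 'n)" "UNIV = {Min UNIV, Max UNIV :: 'n}"
    using xy(2) unfolding xy(1) by (auto simp: min_def max_def)
qed

lemma UNIV_card_3:
  assumes "CARD('n::{finite,linorder}) = 3"
  obtains x y z :: "'n::{finite,linorder}" where "x < y" "y < z" "UNIV = {x, y, z}"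
proof -
  obtain x y z :: 'n where *: "UNIV = {x, y, z}" "x \<noteq> y" "y \<noteq> z" "x \<noteq> z"
    using assms card_3_iff[of "UNIV :: 'n set"] by auto
  show thesis
    using *(2-4) that[of x y z] that[of x z y] that[of y x z] that[of y z x] that[of z x y] that[of z y x]
    unfolding *(1) by (cases x y rule: linorder_cases; cases y z rule: linorder_cases;
        cases x z rule: linorder_cases) (auto simp: insert_commute)
qed

lemma CHAR_eq_of_inj_hom:
  assumes "inj_comm_ring_hom (\<iota> :: 'k::comm_ring_1 \<Rightarrow> 'a::comm_ring_1)"
  shows "CHAR('a) = CHAR('k)"
proof -
  interpret inj_comm_ring_hom \<iota> by fact
  show ?thesis
  proof (rule CHAR_eqI)
    show "of_nat CHAR('k) = (0 :: 'a)"
      by (metis hom_of_nat hom_zero of_nat_CHAR)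
    show "CHAR('k) dvd n" if "of_nat n = (0 :: 'a)" for n
      using that by (metis hom_of_nat hom_0_iff of_nat_eq_0_iff_char_dvd)
  qed
qed

theorem theorem1p5:
  fixes p :: nat
    and \<iota> :: "'k::field \<Rightarrow> 'a::idom"
    and \<sigma> :: "('n::{finite,linorder}, 'a) mpoly \<Rightarrow> ('n, 'a) mpoly"
  assumes "prime p"
    and "CHAR('k) = p" and "inj_comm_ring_hom \<iota>"
    and "\<sigma> \<in> triangular_automorphisms"
    and "has_order \<sigma> p"
  shows "(CARD('n) = 2 \<longrightarrow> exponential_over (range Const) \<sigma>) \<and>
    (CARD('n) = 2 \<longrightarrow>
      (let i1 = Min UNIV; i2 = Max UNIV in
       \<sigma> (Var i1) \<noteq> Var i1 \<longrightarrow>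
       (\<exists>a \<theta>. a \<noteq> 0 \<and> (\<forall>i. p dvd i \<longrightarrow> coeff \<theta> i = 0) \<and>
          \<sigma> (Var i1) = Var i1 + Const a \<and>
          to_fract_mpoly (\<sigma> (Var i2)) =
            Var i2 + Const (inverse (to_fract a)) *
              to_fract_mpoly (subst_poly \<theta> (Var i1) - subst_poly \<theta> (Var i1 + Const a))))) \<and>
    (CARD('n) = 3 \<and> (\<forall>c::'a. c \<noteq> 0 \<longrightarrow> c dvd 1) \<longrightarrow>
      exponential_over (range Const) \<sigma>)"
proof -
  have p: "prime p" "CHAR('a) = p" "\<sigma> ^^ p = id"
    using assms CHAR_eq_of_inj_hom[of \<iota>] by (simp_all add: has_order_def)
  have \<sigma>: "comm_ring_hom \<sigma>" "\<And>c. \<sigma> (Const c) = Const c"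
    using assms(4) unfolding triangular_automorphisms_def algebra_automorphism_def by blast+
  \<comment> \<open>Since \<open>p > 1\<close>, the identity does not have order \<open>p\<close>.
    When all variables but the last are fixed, this makes the last shift nonzero.\<close>
  have nontrivial: "\<exists>i. \<sigma> (Var i) \<noteq> Var i"
  proof (rule ccontr)
    assume *: "\<nexists>i. \<sigma> (Var i) \<noteq> Var i"
    have "\<sigma> q = q" for q
      by (rule mpoly_hom_cong[OF \<sigma>(1) id_hom]) (use * \<sigma>(2) in auto)
    then have "\<sigma> ^^ 1 = id" by auto
    moreover have "\<forall>k. 0 < k \<and> k < p \<longrightarrow> \<sigma> ^^ k \<noteq> id"
      using assms(5) by (simp add: has_order_def)
    ultimately show False using prime_gt_1_nat[OF p(1)] by blast
  qed
  note tri = triangular_unipotent[OF p(1,2) assms(4) p(3)]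
  \<comment> \<open>Parts (i) and (ii) share the case split on whether the first variable is
    fixed.\<close>
  have two: "exponential_over (range Const) \<sigma> \<and>
       (\<sigma> (Var x) \<noteq> Var x \<longrightarrow>
       (\<exists>a \<theta>. a \<noteq> 0 \<and> (\<forall>i. p dvd i \<longrightarrow> coeff \<theta> i = 0) \<and>
          \<sigma> (Var x) = Var x + Const a \<and>
          to_fract_mpoly (\<sigma> (Var y)) =
            Var y + Const (inverse (to_fract a)) *
              to_fract_mpoly (subst_poly \<theta> (Var x) - subst_poly \<theta> (Var x + Const a))))"
    if xy: "x < y" "UNIV = {x, y}" for x y :: 'n
  proof -
    have below: "{..<x} = {}" "{..<y} = {x}" using xy by (force simp: set_eq_iff)+
    obtain g where g: "vars g \<subseteq> {}" "\<sigma> (Var x) = Var x + g" using tri[of x] below by metis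
    obtain f where f: "vars f \<subseteq> {x}" "\<sigma> (Var y) = Var y + f" using tri[of y] below by metis
    obtain a where a: "g = Const a" using g(1) vars_empty_iff[of g] by auto
    show ?thesis
    proof (cases "a = 0")
      case True
      then have x: "\<sigma> (Var x) = Var x" using g(2) a by simp
      have fix_k: "\<sigma> (Var k) = Var k" if "k \<noteq> y" for k
      proof -
        have "k = x" using that xy(2) by blast
        then show ?thesis using x by simp
      qed
      have "f \<noteq> 0" using nontrivial f(2) fix_k by (metis add_0_right)
      moreover have "y \<notin> vars f" using f(1) xy(1) by auto
      ultimately show ?thesis
        using exponential_one_variable[OF \<sigma> fix_k f(2)] x by simp
    next
      case False
      have "exponential_over (range Const) \<sigma>"
        by (rule exponential_two_variables[OF p \<sigma> _ g(2) _ _ _ f(2)])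
          (use xy f(1) False a in auto)
      then show ?thesis
        using two_variables_normal_form[OF p \<sigma> g(2)[unfolded a] False f(2,1)] False g(2) a by metis
    qed
  qed
  have three: "exponential_over (range Const) \<sigma>"
    if unit: "\<And>c :: 'a. c \<noteq> 0 \<Longrightarrow> c dvd 1" and xyz: "x < y" "y < z" "UNIV = {x, y, z}" for x y z :: 'n
  proof -
    have xz: "x < z" using xyz by simp
    have below: "{..<x} = {}" "{..<y} = {x}" "{..<z} = {x, y}"
      using xyz xz by (force simp: set_eq_iff)+
    obtain h where h: "vars h \<subseteq> {}" "\<sigma> (Var x) = Var x + h" using tri[of x] below by metis
    obtain f where f: "vars f \<subseteq> {x}" "\<sigma> (Var y) = Var y + f" using tri[of y] below by metis
    obtain g where g: "vars g \<subseteq> {x, y}" "\<sigma> (Var z) = Var z + g" using tri[of z] below by metis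
    obtain a where a: "h = Const a" using h(1) vars_empty_iff[of h] by auto
    show ?thesis
    \<comment> \<open>A nonzero \<open>a\<close> is a unit because \<open>R\<close> is a field. If
      \<open>a = 0\<close>, then \<open>f\<close> involves only the fixed variable \<open>x\<close>,
      so \<open>y\<close> and \<open>z\<close> move over \<open>R[x]\<close>, or \<open>z\<close>
      alone if also \<open>f = 0\<close>.\<close>
    proof (cases "a = 0")
      case False
      show ?thesis
        by (rule exponential_three_variables[OF p \<sigma> _ _ _ xyz(3) h(2)[unfolded a] unit[OF False] f(2,1) g(2,1)])
          (use xyz xz in auto)
    next
      case True
      then have x: "\<sigma> (Var x) = Var x" using h(2) a by simp
      have fix_k: "\<sigma> (Var k) = Var k" if "k \<noteq> y" "k \<noteq> z" for k
      proof -
        have "k = x" using that xyz(3) by blast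
        then show ?thesis using x by simp
      qed
      show ?thesis
      proof (cases "f = 0")
        case False
        show ?thesis
          by (rule exponential_two_variables[OF p \<sigma> fix_k f(2) False _ _ g(2)])
            (use xyz xz f(1) g(1) in auto)
      next
        case True
        then have fix_k': "\<sigma> (Var k) = Var k" if "k \<noteq> z" for k
          using that f(2) fix_k by (cases "k = y") auto
        have "g \<noteq> 0" using nontrivial g(2) fix_k' by (metis add_0_right)
        moreover have "z \<notin> vars g" using g(1) xyz(2) xz by auto
        ultimately show ?thesis
          using exponential_one_variable[OF \<sigma> fix_k' g(2)] by simp
      qed
    qed
  qed
  show ?thesis
    unfolding Let_def
  proof (intro conjI impI)
    assume "CARD('n) = 3 \<and> (\<forall>c::'a. c \<noteq> 0 \<longrightarrow> c dvd 1)"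
    then show "exponential_over (range Const) \<sigma>"
      using UNIV_card_3[where 'n = 'n] three by metis
  qed (use two[OF UNIV_card_2] in blast)+
qed

end
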